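(* For every $k\in\mathbb{N}$ there exists a convex function $f:\mathbb{R}^2\to\mathbb{R}$ of class $\mathcal{C}^k$ with a unique minimizer at $\mathcal{O}:=(0,0)$ such that: (1) $f$ is real analytic on $\mathbb{R}^2\setminus\{\mathcal{O}\}$; (2) $f$ satisfies the Łojasiewicz gradient inequality at $\mathcal{O}$, i.e. there exist $\vartheta\in(0,1)$, $c>0$ and a neighborhood $U$ of $\mathcal{O}$ such that $\|\nabla f(x)\|\ge c\,|f(x)-f(\mathcal{O})|^{\vartheta}$ for all $x\in U$; (3) every (non-stationary) maximal gradient orbit of $f$ is, up to a translation of time, of the form $\gamma:(-\infty,T)\to\mathbb{R}^2$ with $T<+\infty$ (it blows up in finite positive time), and it spirals infinitely many times both when $t\to-\infty$ (around the origin $\mathcal{O}$) and when $t\to T$ (at infinity).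
   Context: $\|\cdot\|$ is the Euclidean norm. A maximal gradient orbit of $f$ is a maximal solution $\gamma$ of the ordinary differential equation $\gamma'(t)=\nabla f(\gamma(t))$ with $\gamma(0)\neq\mathcal{O}$ (stationary orbits are excluded), defined on an interval containing $0$. For an orbit $\gamma$ avoiding $\mathcal{O}$, let $\alpha(t)$ be a continuous choice of the polar angle of $\gamma(t)$, i.e. $\gamma(t)/\|\gamma(t)\|=(\cos\alpha(t),\sin\alpha(t))$ with $\alpha$ continuous. "$\gamma$ spirals infinitely many times around $\mathcal{O}$ when $t\to-\infty$" means $\gamma(t)\to\mathcal{O}$ and $|\alpha(t)|\to+\infty$ as $t\to-\infty$; "$\gamma$ spirals infinitely many times at infinity when $t\to T$" means $\|\gamma(t)\|\to+\infty$ and $|\alpha(t)|\to+\infty$ as $t\nearrow T$. *)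

theory Defs
  imports "HOL-Analysis.Analysis"
begin

text \<open>The set is meant to be open, so that derivatives are taken at interior points.\<close>
primrec C_k_on :: "nat \<Rightarrow> ('a::euclidean_space \<Rightarrow> 'b::real_normed_vector) \<Rightarrow> 'a set \<Rightarrow> bool" where
  "C_k_on 0 f S \<longleftrightarrow> continuous_on S f"
| "C_k_on (Suc k) f S \<longleftrightarrow>
     (\<forall>x\<in>S. f differentiable (at x)) \<and>
     (\<forall>b\<in>Basis. C_k_on k (\<lambda>x. frechet_derivative f (at x) b) S)"

definition real_analytic_on :: "(real^2 \<Rightarrow> real) \<Rightarrow> (real^2) set \<Rightarrow> bool" where
  "real_analytic_on f S \<longleftrightarrow>
     (\<forall>x\<in>S. \<exists>r>0. \<exists>a :: nat \<Rightarrow> nat \<Rightarrow> real. \<forall>y\<in>ball x r.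
        ((\<lambda>(m, n). a m n * (y $ 1 - x $ 1) ^ m * (y $ 2 - x $ 2) ^ n) has_sum f y) UNIV)"

text \<open>Gradients are used relationally (\<open>GDERIV f x :> v\<close>), so differentiability of \<open>f\<close> at
  the points in question is part of the two conditions below. In particular the inequality
  entails that \<open>f\<close> is differentiable near \<open>x0\<close>.\<close>

definition lojasiewicz_gradient_inequality ::
    "('a::real_inner \<Rightarrow> real) \<Rightarrow> 'a \<Rightarrow> bool" where
  "lojasiewicz_gradient_inequality f x0 \<longleftrightarrow>
     (\<exists>\<theta> c U. 0 < \<theta> \<and> \<theta> < 1 \<and> 0 < c \<and> open U \<and> x0 \<in> U \<and>
        (\<forall>x\<in>U. \<exists>v. GDERIV f x :> v \<and> norm v \<ge> c * \<bar>f x - f x0\<bar> powr \<theta>))"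

definition gradient_solution ::
    "('a::real_inner \<Rightarrow> real) \<Rightarrow> (real \<Rightarrow> 'a) \<Rightarrow> real set \<Rightarrow> bool" where
  "gradient_solution f \<gamma> I \<longleftrightarrow> is_interval I \<and>
     (\<forall>t\<in>I. \<exists>v. GDERIV f (\<gamma> t) :> v \<and> (\<gamma> has_vector_derivative v) (at t within I))"

text \<open>An orbit is a function together with its time domain \<open>I\<close>; values of \<open>\<gamma>\<close> outside \<open>I\<close> are
  irrelevant. The condition \<open>\<gamma> 0 \<noteq> 0\<close> excludes the stationary orbit at the minimizer.\<close>

definition maximal_gradient_orbit ::
    "('a::real_inner \<Rightarrow> real) \<Rightarrow> (real \<Rightarrow> 'a) \<Rightarrow> real set \<Rightarrow> bool" where
  "maximal_gradient_orbit f \<gamma> I \<longleftrightarrow>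
     0 \<in> I \<and> \<gamma> 0 \<noteq> 0 \<and> gradient_solution f \<gamma> I \<and>
     (\<forall>\<delta> J. gradient_solution f \<delta> J \<and> I \<subseteq> J \<and> (\<forall>t\<in>I. \<delta> t = \<gamma> t) \<longrightarrow> J = I)"

definition polar_angle_of :: "(real \<Rightarrow> real^2) \<Rightarrow> real set \<Rightarrow> (real \<Rightarrow> real) \<Rightarrow> bool" where
  "polar_angle_of \<gamma> I \<alpha> \<longleftrightarrow> continuous_on I \<alpha> \<and>
     (\<forall>t\<in>I. \<gamma> t \<noteq> 0 \<and> \<gamma> t /\<^sub>R norm (\<gamma> t) = vector [cos (\<alpha> t), sin (\<alpha> t)])"

text \<open>Two continuous polar angles of the same orbit on an interval differ by a constant, so the
  existential quantifier over \<open>\<alpha>\<close> below is independent of the choice; it also entails that the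
  orbit avoids the origin.\<close>

definition spirals_around_origin_at_bot :: "(real \<Rightarrow> real^2) \<Rightarrow> real \<Rightarrow> bool" where
  "spirals_around_origin_at_bot \<gamma> T \<longleftrightarrow> (\<gamma> \<longlongrightarrow> 0) at_bot \<and>
     (\<exists>\<alpha>. polar_angle_of \<gamma> {..<T} \<alpha> \<and> filterlim (\<lambda>t. \<bar>\<alpha> t\<bar>) at_top at_bot)"

definition spirals_at_infinity_at_left :: "(real \<Rightarrow> real^2) \<Rightarrow> real \<Rightarrow> bool" where
  "spirals_at_infinity_at_left \<gamma> T \<longleftrightarrow> filterlim (\<lambda>t. norm (\<gamma> t)) at_top (at_left T) \<and>
     (\<exists>\<alpha>. polar_angle_of \<gamma> {..<T} \<alpha> \<and> filterlim (\<lambda>t. \<bar>\<alpha> t\<bar>) at_top (at_left T))"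

end

theory Submission
  imports Defs
begin

text \<open>In polar coordinates the example is \<open>f = r\<^sup>p (1 + \<epsilon> cos (ln r - \<theta>))\<close> with \<open>p = 2 k + 4\<close> and
  small \<open>\<epsilon>\<close>. It is a small perturbation of \<open>r\<^sup>p\<close>, whose Hessian is bounded below by a multiple
  of \<open>r\<^bsup>p-2\<^esup>\<close>, while all second derivatives of the perturbation are \<open>O(r\<^bsup>p-2\<^esup>)\<close>; hence \<open>f\<close> is
  convex. With \<open>\<psi> = ln r - \<theta>\<close> the gradient system becomes \<open>(ln r)' = r\<^bsup>p-2\<^esup> M(\<psi>)\<close>,
  \<open>\<psi>' = r\<^bsup>p-2\<^esup> N(\<psi>)\<close> with positive \<open>M\<close>, \<open>N\<close>, so \<open>\<psi>\<close> can serve as independent variable: \<open>ln r\<close>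
  then grows at least linearly and time is the integral of \<open>r\<^bsup>-(p-2)\<^esup> / N\<close>, which converges at
  \<open>+\<infinity>\<close> and diverges at \<open>-\<infinity>\<close>. The angle satisfies
  \<open>d(p \<theta> + ln (1 + \<epsilon> cos \<psi>))/d\<psi> = 2 \<epsilon>\<^sup>2 sin\<^sup>2 \<psi> / (N (1 + \<epsilon> cos \<psi>)) \<ge> 0\<close>, which has infinite integral
  at both ends, so every orbit spirals forever.\<close>

section \<open>Functions homogeneous up to a logarithmic rotation\<close>

text \<open>Since \<open>0 powr c = 0\<close> for every \<open>c\<close>, all these functions take the value 0 at the origin,
  whatever the exponents. \<open>swirl1\<close> and \<open>swirl2\<close> are the partial derivatives; the shift of the
  phase by \<open>pi / 2\<close> stands for the minus sine.\<close>

definition swirl :: "nat \<Rightarrow> nat \<Rightarrow> real \<Rightarrow> real \<Rightarrow> real \<Rightarrow> real^2 \<Rightarrow> real" where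
  "swirl a b c d e x = (x$1)^a * (x$2)^b * (x \<bullet> x) powr c * cos (d * ln (x \<bullet> x) + e)"

definition swirl1 :: "nat \<Rightarrow> nat \<Rightarrow> real \<Rightarrow> real \<Rightarrow> real \<Rightarrow> real^2 \<Rightarrow> real" where
  "swirl1 a b c d e x = real a * swirl (a - 1) b c d e x + 2 * c * swirl (Suc a) b (c - 1) d e x
     + 2 * d * swirl (Suc a) b (c - 1) d (e + pi / 2) x"

definition swirl2 :: "nat \<Rightarrow> nat \<Rightarrow> real \<Rightarrow> real \<Rightarrow> real \<Rightarrow> real^2 \<Rightarrow> real" where
  "swirl2 a b c d e x = real b * swirl a (b - 1) c d e x + 2 * c * swirl a (Suc b) (c - 1) d e x
     + 2 * d * swirl a (Suc b) (c - 1) d (e + pi / 2) x"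

lemma swirl_zero [simp]: "swirl a b c d e 0 = 0"
  by (simp add: swirl_def)

lemma inner_real2: "x \<bullet> (y::real^2) = x$1 * y$1 + x$2 * y$2"
  by (simp add: inner_vec_def sum_2)

lemma norm_real2_sq: "(norm (x::real^2))\<^sup>2 = (x$1)\<^sup>2 + (x$2)\<^sup>2"
  by (simp add: power2_norm_eq_inner inner_real2 flip: power2_eq_square)

lemma inner_powr: "(x::'a::real_inner) \<bullet> x \<noteq> 0 \<Longrightarrow> (x \<bullet> x) powr c = norm x powr (2 * c)"
  by (simp add: norm_eq_sqrt_inner powr_half_sqrt[symmetric] powr_powr)

lemma swirl_has_derivative_nonzero:
  assumes "x \<noteq> 0"
  shows "(swirl a b c d e has_derivative
           (\<lambda>h. h$1 * swirl1 a b c d e x + h$2 * swirl2 a b c d e x)) (at x)"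
proof -
  have s: "x \<bullet> x > 0" using assms by simp
  have P: "((\<lambda>x. (x \<bullet> x) powr c) has_derivative
      (\<lambda>h. 2 * c * (x \<bullet> x) powr (c - 1) * (x \<bullet> h))) (at x)"
    using s by (auto intro!: derivative_eq_intros simp: powr_diff inner_commute field_simps)
  have L: "((\<lambda>x. cos (d * ln (x \<bullet> x) + e)) has_derivative
      (\<lambda>h. 2 * d * cos (d * ln (x \<bullet> x) + (e + pi/2)) * (x \<bullet> h) / (x \<bullet> x))) (at x)"
  proof -
    have "cos (d * ln (x \<bullet> x) + (e + pi/2)) = - sin (d * ln (x \<bullet> x) + e)"
      by (simp add: add.assoc[symmetric] cos_add)
    thus ?thesis using s
      by (auto intro!: derivative_eq_intros simp: inner_commute field_simps fun_eq_iff)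
  qed
  have X1: "((\<lambda>x::real^2. (x$1)^a) has_derivative (\<lambda>h. real a * (x$1)^(a-1) * h$1)) (at x)"
    by (rule has_derivative_eq_rhs[OF has_derivative_power[OF bounded_linear.has_derivative[OF bounded_linear_vec_nth has_derivative_ident]]]) (simp add: ac_simps)
  have X2: "((\<lambda>x::real^2. (x$2)^b) has_derivative (\<lambda>h. real b * (x$2)^(b-1) * h$2)) (at x)"
    by (rule has_derivative_eq_rhs[OF has_derivative_power[OF bounded_linear.has_derivative[OF bounded_linear_vec_nth has_derivative_ident]]]) (simp add: ac_simps)
  have pw: "(x \<bullet> x) powr (c - 1) = (x \<bullet> x) powr c / (x \<bullet> x)"
    using s by (simp add: powr_diff)
  show ?thesis
    unfolding swirl_def[abs_def]
    apply (rule has_derivative_eq_rhs[OF has_derivative_mult[OF has_derivative_mult[OF has_derivative_mult[OF X1 X2] P] L]], rule ext)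
    subgoal for h
      unfolding swirl1_def swirl2_def swirl_def pw inner_real2[of x h]
      by (simp add: algebra_simps add_divide_distrib)
    done
qed

text \<open>Each coordinate is at most the norm and the cosine at most 1, so only the total degree
  \<open>D\<close> remains.\<close>

lemma swirl_bound:
  assumes "real a + real b + 2 * c = D"
  shows "\<bar>swirl a b c d e x\<bar> \<le> norm x powr D"
proof (cases "x = 0")
  case False
  hence r: "norm x > 0" by simp
  have "\<bar>swirl a b c d e x\<bar> \<le> norm x ^ a * norm x ^ b * norm x powr (2 * c) * 1"
    unfolding swirl_def abs_mult power_abs
    using False component_le_norm_cart[of x 1] component_le_norm_cart[of x 2]
    by (intro mult_mono power_mono) (auto simp: inner_powr)
  also have "\<dots> = norm x powr D"
    using r by (simp add: assms[symmetric] powr_add powr_realpow)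
  finally show ?thesis .
qed simp

section \<open>Span of the swirls of a fixed degree\<close>

text \<open>Given inductively so that bounds, derivatives and analyticity pass from single swirls to
  their linear combinations. Multiplying \<open>x\<close> by a positive factor multiplies a swirl by
  the \<open>D\<close>-th power of the factor and shifts its phase.\<close>

inductive spiral_homogeneous :: "real \<Rightarrow> (real^2 \<Rightarrow> real) \<Rightarrow> bool" for D where
  swirl: "real a + real b + 2 * c = D \<Longrightarrow> spiral_homogeneous D (swirl a b c d e)"
| add: "spiral_homogeneous D f \<Longrightarrow> spiral_homogeneous D g \<Longrightarrow> spiral_homogeneous D (\<lambda>x. f x + g x)"
| scale: "spiral_homogeneous D f \<Longrightarrow> spiral_homogeneous D (\<lambda>x. k * f x)"

lemma spiral_homogeneous_bound:
  assumes "spiral_homogeneous D f"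
  shows "\<exists>C\<ge>0. \<forall>x. \<bar>f x\<bar> \<le> C * norm x powr D"
  using assms
proof induction
  case (swirl a b c d e)
  thus ?case using swirl_bound[OF swirl] by (intro exI[of _ 1]) auto
next
  case (add f g)
  then obtain C1 C2 where C: "C1 \<ge> 0" "C2 \<ge> 0" "\<And>x. \<bar>f x\<bar> \<le> C1 * norm x powr D"
    "\<And>x. \<bar>g x\<bar> \<le> C2 * norm x powr D" by blast
  show ?case
  proof (intro exI[of _ "C1 + C2"] conjI allI)
    fix x show "\<bar>f x + g x\<bar> \<le> (C1 + C2) * norm x powr D"
      using C(3)[of x] C(4)[of x] by (simp add: distrib_right)
  qed (use C in simp)
next
  case (scale f k)
  then obtain C1 where C: "C1 \<ge> 0" "\<And>x. \<bar>f x\<bar> \<le> C1 * norm x powr D" by blast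
  show ?case
  proof (intro exI[of _ "\<bar>k\<bar> * C1"] conjI allI)
    fix x show "\<bar>k * f x\<bar> \<le> \<bar>k\<bar> * C1 * norm x powr D"
      using mult_left_mono[OF C(2)[of x], of "\<bar>k\<bar>"] by (simp add: abs_mult ac_simps)
  qed (use C in simp)
qed

lemma spiral_homogeneous_zero:
  assumes "spiral_homogeneous D f"
  shows "f 0 = 0"
proof -
  obtain C where "\<And>x. \<bar>f x\<bar> \<le> C * norm x powr D"
    using spiral_homogeneous_bound[OF assms] by blast
  from this[of 0] show ?thesis by simp
qed

text \<open>Covers the first term of \<open>swirl1\<close> and \<open>swirl2\<close> when its
  coefficient is 0; the exponent \<open>D / 2\<close> gives the swirl that is multiplied by 0 the
  right degree.\<close>

lemma spiral_homogeneous_null: "spiral_homogeneous D (\<lambda>x. 0)"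
  using spiral_homogeneous.scale[OF spiral_homogeneous.swirl[of 0 0 "D/2" D 0 0], of 0] by simp

lemma spiral_homogeneous_swirl1:
  assumes "real a + real b + 2 * c = D"
  shows "spiral_homogeneous (D - 1) (swirl1 a b c d e)"
proof -
  \<comment> \<open>For \<open>a = 0\<close> the truncated difference \<open>a - 1\<close> would
    give a swirl of the wrong degree, but the factor \<open>real a\<close> then makes the term
    zero.\<close>
  have "spiral_homogeneous (D - 1) (\<lambda>x. real a * swirl (a - 1) b c d e x)"
    using assms by (cases a) (auto intro!: spiral_homogeneous.scale spiral_homogeneous.swirl spiral_homogeneous_null)
  from spiral_homogeneous.add[OF spiral_homogeneous.add[OF this
    spiral_homogeneous.scale[OF spiral_homogeneous.swirl]]
    spiral_homogeneous.scale[OF spiral_homogeneous.swirl]]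
  show ?thesis unfolding swirl1_def[abs_def] using assms by auto
qed

lemma spiral_homogeneous_swirl2:
  assumes "real a + real b + 2 * c = D"
  shows "spiral_homogeneous (D - 1) (swirl2 a b c d e)"
proof -
  have "spiral_homogeneous (D - 1) (\<lambda>x. real b * swirl a (b - 1) c d e x)"
    using assms by (cases b) (auto intro!: spiral_homogeneous.scale spiral_homogeneous.swirl spiral_homogeneous_null)
  from spiral_homogeneous.add[OF spiral_homogeneous.add[OF this
    spiral_homogeneous.scale[OF spiral_homogeneous.swirl]]
    spiral_homogeneous.scale[OF spiral_homogeneous.swirl]]
  show ?thesis unfolding swirl2_def[abs_def] using assms by auto
qed

text \<open>The bound forces \<open>f 0 = 0\<close> and makes the difference quotient at most
  \<open>C * norm x powr (D - 1)\<close>, which tends to 0.\<close>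

lemma has_derivative_zero_of_powr_bound:
  fixes f :: "'a::real_normed_vector \<Rightarrow> real"
  assumes "D > 1" "\<And>x. \<bar>f x\<bar> \<le> C * norm x powr D"
  shows "(f has_derivative (\<lambda>h. 0)) (at 0)"
proof (rule has_derivativeI_sandwich[of 1])
  have f0: "f 0 = 0" using assms(2)[of 0] by simp
  show "((\<lambda>y. C * norm y powr (D - 1)) \<longlongrightarrow> 0) (at (0::'a))"
    using assms by (intro tendsto_mult_right_zero tendsto_zero_powrI[where b = "D - 1"] tendsto_norm_zero) auto
  fix y :: 'a assume "y \<noteq> 0"
  thus "norm (f y - f 0 - 0) / norm (y - 0) \<le> C * norm y powr (D - 1)"
    using assms(2)[of y] f0 by (simp add: powr_diff field_simps)
qed auto

text \<open>In degree above 1 the formula extends to the origin: \<open>swirl1\<close> and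
  \<open>swirl2\<close> vanish there by \<open>0 powr c = 0\<close>, and so does the
  derivative.\<close>

lemma swirl_has_derivative:
  assumes "x \<noteq> 0 \<or> real a + real b + 2 * c > 1"
  shows "(swirl a b c d e has_derivative
           (\<lambda>h. h$1 * swirl1 a b c d e x + h$2 * swirl2 a b c d e x)) (at x)"
proof (cases "x = 0")
  case True
  have "(swirl a b c d e has_derivative (\<lambda>h. 0)) (at 0)"
    using True assms by (intro has_derivative_zero_of_powr_bound[of "real a + real b + 2 * c" _ 1])
      (auto simp: swirl_bound)
  moreover have "swirl1 a b c d e 0 = 0" "swirl2 a b c d e 0 = 0"
    by (simp_all add: swirl1_def swirl2_def)
  ultimately show ?thesis using True by simp
qed (rule swirl_has_derivative_nonzero)

text \<open>The span is closed under partial derivatives, at the cost of one degree. The same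
  \<open>f1\<close> and \<open>f2\<close> serve at all points, so the lemma can be iterated.\<close>

lemma spiral_homogeneous_derivative:
  assumes "spiral_homogeneous D f"
  shows "\<exists>f1 f2. spiral_homogeneous (D - 1) f1 \<and> spiral_homogeneous (D - 1) f2 \<and>
    (\<forall>x. x \<noteq> 0 \<or> D > 1 \<longrightarrow> (f has_derivative (\<lambda>h. h$1 * f1 x + h$2 * f2 x)) (at x))"
  using assms
proof induction
  case (swirl a b c d e)
  show ?case
  proof (intro exI conjI allI impI)
    fix x :: "real^2" assume "x \<noteq> 0 \<or> D > 1"
    thus "(swirl a b c d e has_derivative
        (\<lambda>h. h$1 * swirl1 a b c d e x + h$2 * swirl2 a b c d e x)) (at x)"
      using swirl by (intro swirl_has_derivative) simp
  qed (rule spiral_homogeneous_swirl1 spiral_homogeneous_swirl2, rule swirl)+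
next
  case (add f g)
  obtain f1 f2 where f: "spiral_homogeneous (D - 1) f1" "spiral_homogeneous (D - 1) f2"
    "\<forall>x. x \<noteq> 0 \<or> D > 1 \<longrightarrow> (f has_derivative (\<lambda>h. h$1 * f1 x + h$2 * f2 x)) (at x)"
    using add.IH(1) by (elim exE conjE)
  obtain g1 g2 where g: "spiral_homogeneous (D - 1) g1" "spiral_homogeneous (D - 1) g2"
    "\<forall>x. x \<noteq> 0 \<or> D > 1 \<longrightarrow> (g has_derivative (\<lambda>h. h$1 * g1 x + h$2 * g2 x)) (at x)"
    using add.IH(2) by (elim exE conjE)
  show ?case
  proof (intro exI conjI allI impI)
    fix x :: "real^2" assume x: "x \<noteq> 0 \<or> D > 1"
    show "((\<lambda>x. f x + g x) has_derivative (\<lambda>h. h$1 * (f1 x + g1 x) + h$2 * (f2 x + g2 x))) (at x)"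
      by (rule has_derivative_eq_rhs[OF has_derivative_add[OF f(3)[rule_format, OF x] g(3)[rule_format, OF x]]])
         (simp add: algebra_simps)
  qed (rule spiral_homogeneous.add, rule f g, rule f g)+
next
  case (scale f k)
  obtain f1 f2 where f: "spiral_homogeneous (D - 1) f1" "spiral_homogeneous (D - 1) f2"
    "\<forall>x. x \<noteq> 0 \<or> D > 1 \<longrightarrow> (f has_derivative (\<lambda>h. h$1 * f1 x + h$2 * f2 x)) (at x)"
    using scale.IH by (elim exE conjE)
  show ?case
  proof (intro exI conjI allI impI)
    fix x :: "real^2" assume x: "x \<noteq> 0 \<or> D > 1"
    show "((\<lambda>x. k * f x) has_derivative (\<lambda>h. h$1 * (k * f1 x) + h$2 * (k * f2 x))) (at x)"
      by (rule has_derivative_eq_rhs[OF has_derivative_mult_right[OF f(3)[rule_format, OF x]]])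
         (simp add: algebra_simps)
  qed (rule spiral_homogeneous.scale, rule f)+
qed

text \<open>Off the origin continuity follows from differentiability; at the origin the bound by a
  multiple of \<open>norm x powr D\<close> tends to 0.\<close>

lemma spiral_homogeneous_continuous:
  assumes "spiral_homogeneous D f" "D > 0"
  shows "continuous_on UNIV f"
proof (rule continuous_at_imp_continuous_on, rule ballI)
  fix x :: "real^2"
  show "isCont f x"
  proof (cases "x = 0")
    case True
    obtain C where C: "\<And>x. \<bar>f x\<bar> \<le> C * norm x powr D"
      using spiral_homogeneous_bound[OF assms(1)] by blast
    have "((\<lambda>y. C * norm y powr D) \<longlongrightarrow> 0) (at (0::real^2))"
      using assms by (intro tendsto_mult_right_zero tendsto_zero_powrI[where b = D] tendsto_norm_zero) auto
    hence "(f \<longlongrightarrow> 0) (at 0)"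
      by (rule Lim_null_comparison[rotated]) (simp add: C)
    thus ?thesis using True spiral_homogeneous_zero[OF assms(1)] by (simp add: isCont_def)
  next
    case False
    from spiral_homogeneous_derivative[OF assms(1)] obtain f1 f2 where
      "\<forall>x. x \<noteq> 0 \<or> D > 1 \<longrightarrow> (f has_derivative (\<lambda>h. h$1 * f1 x + h$2 * f2 x)) (at x)"
      by (elim exE conjE)
    thus ?thesis using False by (auto intro: has_derivative_continuous)
  qed
qed

text \<open>Each derivative lowers the degree by one, so \<open>D > real k\<close> permits
  \<open>k\<close> differentiations at the origin and leaves functions of positive degree, which are
  continuous.\<close>

lemma spiral_homogeneous_C_k:
  assumes "spiral_homogeneous D f" "D > real k"
  shows "C_k_on k f UNIV"
  using assms
proof (induction k arbitrary: D f)
  case 0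
  thus ?case using spiral_homogeneous_continuous by simp
next
  case (Suc k)
  obtain f1 f2 where *: "spiral_homogeneous (D - 1) f1" "spiral_homogeneous (D - 1) f2"
    and der: "\<And>x. (f has_derivative (\<lambda>h. h$1 * f1 x + h$2 * f2 x)) (at x)"
    using spiral_homogeneous_derivative[OF Suc.prems(1)] Suc.prems(2) by auto
  have fd: "frechet_derivative f (at x) = (\<lambda>h. h$1 * f1 x + h$2 * f2 x)" for x
    using frechet_derivative_at[OF der] by simp
  have "C_k_on k (\<lambda>x. b$1 * f1 x + b$2 * f2 x) UNIV" for b :: "real^2"
    using Suc.prems(2) by (intro Suc.IH[of "D - 1"] spiral_homogeneous.intros *) auto
  thus ?case using der by (auto simp: fd differentiable_def)
qed

section \<open>Real analyticity\<close>

text \<open>The coefficients are complex, although the variables are real, so that a real power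
  times the cosine of a logarithm becomes the real part of one complex power.\<close>

definition double_series :: "(nat \<Rightarrow> nat \<Rightarrow> complex) \<Rightarrow> real \<Rightarrow> real \<Rightarrow> complex \<Rightarrow> bool" where
  "double_series a u v S \<longleftrightarrow> ((\<lambda>(m, n). a m n * of_real u ^ m * of_real v ^ n) has_sum S) UNIV"

lemma double_series_add:
  assumes "double_series a u v S" "double_series b u v T"
  shows "double_series (\<lambda>m n. a m n + b m n) u v (S + T)"
  using has_sum_add[OF assms[unfolded double_series_def]]
  by (simp add: double_series_def case_prod_unfold algebra_simps)

lemma double_series_affine:
  "double_series (\<lambda>m n. if (m, n) = (0, 0) then c else if (m, n) = (1, 0) then d
      else if (m, n) = (0, 1) then e else 0) u v (c + d * of_real u + e * of_real v)"
  unfolding double_series_def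
proof (rule has_sum_finite_neutralI[of "{(0,0), (1,0), (0,1)}"])
  show "c + d * of_real u + e * of_real v = (\<Sum>x\<in>{(0,0), (1,0), (0,1)}. case x of (m, n) \<Rightarrow>
    (if (m, n) = (0, 0) then c else if (m, n) = (1, 0) then d
      else if (m, n) = (0, 1) then e else 0) * complex_of_real u ^ m * of_real v ^ n)"
    by simp
qed (auto split: if_splits)

text \<open>Summable complex families are absolutely summable; hence the family of products is
  absolutely summable and its sum can be computed iteratively.\<close>

lemma has_sum_complex_times:
  fixes f :: "'a \<Rightarrow> complex" and g :: "'b \<Rightarrow> complex"
  assumes "(f has_sum S) A" "(g has_sum T) B"
  shows "((\<lambda>(x, y). f x * g y) has_sum (S * T)) (A \<times> B)"
proof (rule has_sum_SigmaI)
  show "((\<lambda>y. case (x, y) of (x, y) \<Rightarrow> f x * g y) has_sum (f x * T)) B" for x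
    using has_sum_cmult_right[OF assms(2), of "f x"] by simp
  show "((\<lambda>x. f x * T) has_sum S * T) A"
    using has_sum_cmult_left[OF assms(1)] by simp
  have f: "(\<lambda>x. norm (f x)) summable_on A" and g: "(\<lambda>x. norm (g x)) summable_on B"
    using assms summable_on_iff_abs_summable_on_complex by (auto simp: summable_on_def)
  have "(\<lambda>z. norm (case z of (x, y) \<Rightarrow> f x * g y)) summable_on A \<times> B"
  proof (rule summable_on_SigmaI[where g = "\<lambda>x. norm (f x) * (\<Sum>\<^sub>\<infinity>y\<in>B. norm (g y))"])
    show "((\<lambda>y. norm (case (x, y) of (x, y) \<Rightarrow> f x * g y)) has_sum (norm (f x) * (\<Sum>\<^sub>\<infinity>y\<in>B. norm (g y)))) B" for x
      using has_sum_cmult_right[OF has_sum_infsum[OF g], of "norm (f x)"] by (simp add: norm_mult)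
    show "(\<lambda>x. norm (f x) * (\<Sum>\<^sub>\<infinity>y\<in>B. norm (g y))) summable_on A"
      by (rule summable_on_cmult_left[OF f])
  qed simp
  thus "(\<lambda>(x, y). f x * g y) summable_on A \<times> B"
    using summable_on_iff_abs_summable_on_complex by blast
qed

text \<open>The Cauchy product in two variables: products of monomials are regrouped by their total
  exponents \<open>(m, n)\<close>, each of which arises from finitely many
  \<open>(i, j)\<close>.\<close>

lemma double_series_mult:
  assumes "double_series a u v S" "double_series b u v T"
  shows "double_series (\<lambda>m n. \<Sum>(i, j)\<in>{..m} \<times> {..n}. a i j * b (m - i) (n - j)) u v (S * T)"
proof -
  define F where "F = (\<lambda>((i, j), (k, l)). (a i j * complex_of_real u ^ i * of_real v ^ j) *
    (b k l * of_real u ^ k * of_real v ^ l))"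
  define G where "G = (\<lambda>((m, n), (i, j)). a i j * b (m - i) (n - j) * complex_of_real u ^ m * of_real v ^ n)"
  have "(F has_sum S * T) (UNIV \<times> UNIV)"
    using has_sum_complex_times[OF assms[unfolded double_series_def]]
    by (simp add: F_def case_prod_unfold)
  also have "?this \<longleftrightarrow> (G has_sum S * T) (Sigma UNIV (\<lambda>(m, n). {..m} \<times> {..n}))"
    by (rule has_sum_reindex_bij_witness[of _
        "\<lambda>((m, n), (i, j)). ((i, j), (m - i, n - j))" "\<lambda>((i, j), (k, l)). ((i + k, j + l), (i, j))"])
      (auto simp: F_def G_def power_add)
  finally have "(G has_sum S * T) (Sigma UNIV (\<lambda>(m, n). {..m} \<times> {..n}))" .
  hence "((\<lambda>(m, n). (\<Sum>(i, j)\<in>{..m} \<times> {..n}. a i j * b (m - i) (n - j)) * of_real u ^ m * of_real v ^ n)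
     has_sum S * T) UNIV"
  proof (rule has_sum_SigmaD)
    fix z :: "nat \<times> nat"
    obtain m n where z: "z = (m, n)" by force
    show "((\<lambda>y. G (z, y)) has_sum (case z of (m, n) \<Rightarrow>
        (\<Sum>(i, j)\<in>{..m} \<times> {..n}. a i j * b (m - i) (n - j)) * of_real u ^ m * of_real v ^ n))
      (case z of (m, n) \<Rightarrow> {..m} \<times> {..n})"
      unfolding z by (auto intro!: has_sum_finiteI simp: G_def sum_distrib_right case_prod_unfold)
  qed
  thus ?thesis by (simp add: double_series_def)
qed

text \<open>The binomial theorem expands each power of the linear form. Assumption \<open>c\<close>
  is convergence of a majorant, which justifies the rearrangement into a double series.\<close>

lemma double_series_linear_power:
  assumes c: "summable (\<lambda>k. norm (c k) * (norm \<alpha> * \<bar>u\<bar> + norm \<beta> * \<bar>v\<bar>) ^ k)"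
  shows "double_series (\<lambda>m n. c (m + n) * of_nat (m + n choose m) * \<alpha> ^ m * \<beta> ^ n) u v
           (\<Sum>k. c k * (\<alpha> * of_real u + \<beta> * of_real v) ^ k)"
proof -
  define X where "X = \<alpha> * of_real u"
  define Y where "Y = \<beta> * of_real v"
  have nX: "norm X = norm \<alpha> * \<bar>u\<bar>" "norm Y = norm \<beta> * \<bar>v\<bar>"
    by (simp_all add: X_def Y_def norm_mult)
  define F where "F = (\<lambda>(k, m). c k * (of_nat (k choose m) * X ^ m * Y ^ (k - m)))"
  define G where "G = (\<lambda>(m, n). (c (m + n) * of_nat (m + n choose m) * \<alpha> ^ m * \<beta> ^ n) * complex_of_real u ^ m * of_real v ^ n)"
  have sN: "(\<lambda>k. norm (c k) * (norm X + norm Y) ^ k) summable_on UNIV"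
    using c by (intro norm_summable_imp_summable_on) (simp add: nX)
  \<comment> \<open>The norms in row \<open>k\<close> add up, again by the binomial theorem, to the
    \<open>k\<close>-th term of the majorant.\<close>
  have "(\<lambda>z. norm (F z)) summable_on Sigma UNIV (\<lambda>k. {..k})"
  proof (rule summable_on_SigmaI[OF _ sN])
    fix k
    have "(\<Sum>m\<le>k. norm (F (k, m))) = norm (c k) * (norm X + norm Y) ^ k"
      unfolding binomial_ring by (simp add: F_def sum_distrib_left norm_mult norm_power)
    thus "((\<lambda>m. norm (F (k, m))) has_sum norm (c k) * (norm X + norm Y) ^ k) {..k}"
      by (intro has_sum_finiteI) auto
  qed simp
  hence sF: "F summable_on Sigma UNIV (\<lambda>k. {..k})"
    using summable_on_iff_abs_summable_on_complex by blast
  have "summable (\<lambda>k. norm (c k * (X + Y) ^ k))"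
  proof (rule summable_comparison_test'[OF c, of 0])
    fix k
    have "norm (X + Y) ^ k \<le> (norm X + norm Y) ^ k"
      by (intro power_mono norm_triangle_ineq) auto
    thus "norm (norm (c k * (X + Y) ^ k)) \<le> norm (c k) * (norm \<alpha> * \<bar>u\<bar> + norm \<beta> * \<bar>v\<bar>) ^ k"
      by (simp add: norm_mult norm_power nX mult_left_mono)
  qed
  hence s: "((\<lambda>k. c k * (X + Y) ^ k) has_sum (\<Sum>k. c k * (X + Y) ^ k)) UNIV"
    by (intro norm_summable_imp_has_sum summable_sums) (auto dest: summable_norm_cancel)
  have "(F has_sum (\<Sum>k. c k * (X + Y) ^ k)) (Sigma UNIV (\<lambda>k. {..k}))"
  proof (rule has_sum_SigmaI[OF _ s sF])
    fix k
    show "((\<lambda>m. F (k, m)) has_sum c k * (X + Y) ^ k) {..k}"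
      unfolding binomial_ring by (intro has_sum_finiteI) (auto simp: F_def sum_distrib_left)
  qed
  \<comment> \<open>The indices \<open>k\<close> and \<open>m \<le> k\<close> are exchanged for the
    exponents \<open>m\<close> and \<open>n = k - m\<close>.\<close>
  also have "?this \<longleftrightarrow> (G has_sum (\<Sum>k. c k * (X + Y) ^ k)) UNIV"
    by (rule has_sum_reindex_bij_witness[of _ "\<lambda>(m, n). (m + n, m)" "\<lambda>(k, m). (m, k - m)"])
       (auto simp: F_def G_def X_def Y_def power_mult_distrib)
  finally show ?thesis by (simp add: double_series_def G_def X_def Y_def)
qed

section \<open>Analytic complex-valued functions of two real variables\<close>

definition complex_analytic_at :: "(real^2 \<Rightarrow> complex) \<Rightarrow> real^2 \<Rightarrow> bool" where
  "complex_analytic_at F x \<longleftrightarrow> (\<exists>r>0. \<exists>a. \<forall>y\<in>ball x r. double_series a (y$1 - x$1) (y$2 - x$2) (F y))"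

lemma complex_analytic_at_add:
  assumes "complex_analytic_at F x" "complex_analytic_at G x"
  shows "complex_analytic_at (\<lambda>y. F y + G y) x"
proof -
  obtain r a s b where "r > 0" "\<forall>y\<in>ball x r. double_series a (y$1 - x$1) (y$2 - x$2) (F y)"
     "s > 0" "\<forall>y\<in>ball x s. double_series b (y$1 - x$1) (y$2 - x$2) (G y)"
    using assms unfolding complex_analytic_at_def by blast
  thus ?thesis unfolding complex_analytic_at_def
    by (intro exI[of _ "min r s"] conjI exI[of _ "\<lambda>m n. a m n + b m n"])
       (auto intro: double_series_add)
qed

lemma complex_analytic_at_mult:
  assumes "complex_analytic_at F x" "complex_analytic_at G x"
  shows "complex_analytic_at (\<lambda>y. F y * G y) x"
proof -
  obtain r a s b where "r > 0" "\<forall>y\<in>ball x r. double_series a (y$1 - x$1) (y$2 - x$2) (F y)"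
     "s > 0" "\<forall>y\<in>ball x s. double_series b (y$1 - x$1) (y$2 - x$2) (G y)"
    using assms unfolding complex_analytic_at_def by blast
  thus ?thesis unfolding complex_analytic_at_def
    by (intro exI[of _ "min r s"] conjI
        exI[of _ "\<lambda>m n. \<Sum>(i, j)\<in>{..m} \<times> {..n}. a i j * b (m - i) (n - j)"])
       (auto intro: double_series_mult)
qed

text \<open>Covers constants and both coordinates at once; expanding about \<open>x\<close> only
  changes the constant term.\<close>

lemma complex_analytic_at_affine: "complex_analytic_at (\<lambda>y. c + d * of_real (y$1) + e * of_real (y$2)) x"
proof -
  have eq: "c + d * of_real (y$1) + e * of_real (y$2) = (c + d * of_real (x$1) + e * of_real (x$2)) +
     d * of_real (y$1 - x$1) + e * of_real (y$2 - x$2)" for y :: "real^2"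
    by (simp add: algebra_simps)
  have "double_series (\<lambda>m n. if (m, n) = (0, 0) then c + d * of_real (x$1) + e * of_real (x$2)
      else if (m, n) = (1, 0) then d else if (m, n) = (0, 1) then e else 0)
      (y$1 - x$1) (y$2 - x$2) (c + d * of_real (y$1) + e * of_real (y$2))" for y :: "real^2"
    unfolding eq[of y] by (rule double_series_affine)
  thus ?thesis unfolding complex_analytic_at_def
    by (intro exI[of _ 1] conjI exI ballI) auto
qed

lemma complex_analytic_at_const: "complex_analytic_at (\<lambda>y. c) x"
  using complex_analytic_at_affine[of c 0 0] by simp

lemma complex_analytic_at_power:
  "complex_analytic_at F x \<Longrightarrow> complex_analytic_at (\<lambda>y. F y ^ n) x"
  by (induction n) (auto intro: complex_analytic_at_mult complex_analytic_at_const)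

text \<open>The binomial series in a linear form. Both coordinates of \<open>y - x\<close> are at
  most its norm, so the radius \<open>1 / (2 * K)\<close> keeps the majorant \<open>R\<close> of the
  form below 1.\<close>

lemma complex_analytic_at_one_plus_powr:
  assumes "norm \<alpha> \<le> K" "norm \<beta> \<le> K" "K > 0"
  shows "complex_analytic_at
    (\<lambda>y. (1 + (\<alpha> * of_real (y$1 - x$1) + \<beta> * of_real (y$2 - x$2))) powr w) x"
  unfolding complex_analytic_at_def
proof (intro exI[of _ "1 / (2 * K)"] conjI exI ballI)
  fix y assume "y \<in> ball x (1 / (2 * K))"
  hence y: "norm (y - x) < 1 / (2 * K)" by (simp add: dist_norm norm_minus_commute)
  let ?u = "y$1 - x$1" and ?v = "y$2 - x$2"
  have "\<bar>?u\<bar> \<le> norm (y - x)" "\<bar>?v\<bar> \<le> norm (y - x)"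
    using component_le_norm_cart[of "y - x" 1] component_le_norm_cart[of "y - x" 2] by auto
  define R where "R = norm \<alpha> * \<bar>?u\<bar> + norm \<beta> * \<bar>?v\<bar>"
  have "R \<le> K * norm (y - x) + K * norm (y - x)"
    unfolding R_def using assms \<open>\<bar>?u\<bar> \<le> _\<close> \<open>\<bar>?v\<bar> \<le> _\<close> by (intro add_mono mult_mono) auto
  also have "\<dots> < 1" using y assms by (simp add: field_simps)
  finally have R: "R < 1" .
  have R0: "R \<ge> 0" by (simp add: R_def)
  \<comment> \<open>Convergence of the power series at \<open>R'\<close> gives absolute convergence
    at the strictly smaller \<open>R\<close>.\<close>
  obtain R' where R': "R < R'" "R' < 1" using R dense by blast
  have "summable (\<lambda>n. (w gchoose n) * of_real R' ^ n)"
    using gen_binomial_complex[of "of_real R'" w] R0 R' by (auto simp: sums_iff)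
  from powser_insidea[OF this, of "of_real R"]
  have "summable (\<lambda>n. norm (w gchoose n) * R ^ n)"
    using R0 R' by (simp add: norm_mult norm_power)
  from double_series_linear_power[OF this[unfolded R_def]]
  have ds: "double_series (\<lambda>m n. (w gchoose (m + n)) * of_nat (m + n choose m) * \<alpha> ^ m * \<beta> ^ n) ?u ?v
           (\<Sum>k. (w gchoose k) * (\<alpha> * of_real ?u + \<beta> * of_real ?v) ^ k)" .
  have "norm (\<alpha> * of_real ?u + \<beta> * of_real ?v) \<le> R"
    unfolding R_def by (rule order.trans[OF norm_triangle_ineq]) (simp only: norm_mult norm_of_real order.refl)
  hence "norm (\<alpha> * of_real ?u + \<beta> * of_real ?v) < 1" using R by linarith
  from gen_binomial_complex[OF this, of w] ds
  show "double_series (\<lambda>m n. (w gchoose (m + n)) * of_nat (m + n choose m) * \<alpha> ^ m * \<beta> ^ n) ?u ?v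
    ((1 + (\<alpha> * of_real ?u + \<beta> * of_real ?v)) powr w)"
    by (simp add: sums_iff)
qed (use assms in simp)

text \<open>As complex numbers \<open>y = z0 (1 + \<zeta>)\<close> with \<open>\<zeta>\<close> linear in \<open>y - x\<close>, so that
  \<open>(y \<bullet> y)\<^sup>w = (x \<bullet> x)\<^sup>w (1 + \<zeta>)\<^sup>w (1 + cnj \<zeta>)\<^sup>w\<close> is a product of binomial series.\<close>

lemma complex_analytic_at_norm_powr:
  assumes "x \<noteq> 0"
  shows "complex_analytic_at (\<lambda>y. exp (w * of_real (ln (y \<bullet> y)))) x"
proof -
  define z0 where "z0 = Complex (x$1) (x$2)"
  have nz: "norm (Complex (y$1) (y$2)) ^ 2 = y \<bullet> y" for y :: "real^2"
    by (simp add: cmod_power2 inner_real2 flip: power2_eq_square)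
  have z0: "z0 \<noteq> 0" using nz[of x] assms by (auto simp: z0_def)
  define \<zeta> where "\<zeta> = (\<lambda>y::real^2. (1 / z0) * of_real (y$1 - x$1) + (\<i> / z0) * of_real (y$2 - x$2))"
  have cnj: "cnj (\<zeta> y) = cnj (1 / z0) * of_real (y$1 - x$1) + cnj (\<i> / z0) * of_real (y$2 - x$2)" for y
    by (simp add: \<zeta>_def)
  have K: "norm (1 / z0) \<le> 1 / norm z0" "norm (\<i> / z0) \<le> 1 / norm z0"
     "norm (cnj (1 / z0)) \<le> 1 / norm z0" "norm (cnj (\<i> / z0)) \<le> 1 / norm z0" "1 / norm z0 > 0"
    using z0 by (simp_all add: norm_divide)
  have "complex_analytic_at (\<lambda>y. exp (w * of_real (ln (x \<bullet> x))) *
     ((1 + \<zeta> y) powr w * (1 + cnj (\<zeta> y)) powr w)) x"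
    unfolding cnj unfolding \<zeta>_def
    by (intro complex_analytic_at_mult complex_analytic_at_const
        complex_analytic_at_one_plus_powr[of _ "1 / norm z0"] K)
  then obtain r a where r: "r > 0" and a: "\<And>y. y \<in> ball x r \<Longrightarrow> double_series a (y$1 - x$1) (y$2 - x$2)
     (exp (w * of_real (ln (x \<bullet> x))) * ((1 + \<zeta> y) powr w * (1 + cnj (\<zeta> y)) powr w))"
    unfolding complex_analytic_at_def by blast
  have eq: "exp (w * of_real (ln (x \<bullet> x))) * ((1 + \<zeta> y) powr w * (1 + cnj (\<zeta> y)) powr w)
     = exp (w * of_real (ln (y \<bullet> y)))" if y: "y \<in> ball x (norm z0)" for y
  proof -
    have "z0 * \<zeta> y = Complex (y$1) (y$2) - z0"
    proof -
      have "z0 * \<zeta> y = of_real (y$1 - x$1) + \<i> * of_real (y$2 - x$2)"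
        using z0 by (simp add: \<zeta>_def distrib_left)
      thus ?thesis by (simp add: z0_def complex_eq_iff)
    qed
    hence zy: "Complex (y$1) (y$2) = z0 * (1 + \<zeta> y)" by (simp add: algebra_simps)
    have "norm (Complex (y$1) (y$2) - z0) ^ 2 = norm (y - x) ^ 2"
      by (simp add: z0_def cmod_power2 norm_real2_sq)
    hence "norm (z0 * \<zeta> y) = norm (y - x)"
      unfolding \<open>z0 * \<zeta> y = _\<close> by (rule power2_eq_imp_eq) simp_all
    hence "norm z0 * norm (\<zeta> y) < norm z0" using y
      by (simp add: norm_mult dist_norm norm_minus_commute)
    hence "norm (\<zeta> y) < 1" using z0 by simp
    \<comment> \<open>With \<open>\<zeta> y\<close> inside the unit disc,
      \<open>1 + \<zeta> y\<close> stays off the branch cut of \<open>Ln\<close>. There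
      \<open>Ln\<close> commutes with conjugation, so the two logarithms add up to the real number
      \<open>2 * ln (norm (1 + \<zeta> y))\<close>.\<close>
    hence re: "Re (1 + \<zeta> y) > 0" using abs_Re_le_cmod[of "\<zeta> y"] by simp
    hence n0: "1 + \<zeta> y \<noteq> 0" "1 + cnj (\<zeta> y) \<noteq> 0" by (auto simp: complex_eq_iff)
    have nn: "1 + \<zeta> y \<notin> \<real>\<^sub>\<le>\<^sub>0" using re by (auto simp: complex_nonpos_Reals_iff)
    have "Ln (1 + cnj (\<zeta> y)) = cnj (Ln (1 + \<zeta> y))"
      using cnj_Ln[OF nn] by simp
    hence "Ln (1 + \<zeta> y) + Ln (1 + cnj (\<zeta> y)) = of_real (2 * ln (norm (1 + \<zeta> y)))"
      using n0 by (simp add: complex_add_cnj Re_Ln)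
    moreover have "ln (y \<bullet> y) = ln (x \<bullet> x) + 2 * ln (norm (1 + \<zeta> y))"
    proof -
      have "y \<bullet> y = (x \<bullet> x) * norm (1 + \<zeta> y) ^ 2"
        using nz[of y] nz[of x] zy by (simp add: norm_mult power_mult_distrib z0_def)
      thus ?thesis using assms n0 by (simp add: ln_mult ln_realpow)
    qed
    ultimately have *: "complex_of_real (ln (y \<bullet> y)) =
        of_real (ln (x \<bullet> x)) + (Ln (1 + \<zeta> y) + Ln (1 + cnj (\<zeta> y)))"
      by simp
    show ?thesis unfolding * using n0 by (simp add: powr_def exp_add distrib_left)
  qed
  show ?thesis unfolding complex_analytic_at_def
  proof (intro exI[of _ "min r (norm z0)"] conjI exI[of _ a] ballI)
    fix y assume "y \<in> ball x (min r (norm z0))"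
    thus "double_series a (y$1 - x$1) (y$2 - x$2) (exp (w * of_real (ln (y \<bullet> y))))"
      using a[of y] eq[of y] by simp
  qed (use r z0 in simp)
qed

section \<open>Analyticity of the swirls and of their span\<close>

text \<open>The power of \<open>y \<bullet> y\<close> with exponent \<open>Complex c d\<close> has
  modulus \<open>(y \<bullet> y) powr c\<close> and argument \<open>d * ln (y \<bullet> y)\<close>;
  the factor \<open>cis e\<close> adds the phase.\<close>

lemma swirl_eq_Re:
  "\<exists>F. (\<forall>x. x \<noteq> 0 \<longrightarrow> complex_analytic_at F x) \<and> (\<forall>y. y \<noteq> 0 \<longrightarrow> Re (F y) = swirl a b c d e y)"
proof (intro exI conjI allI impI)
  \<comment> \<open>The coordinates are written as affine forms to match
    \<open>complex_analytic_at_affine\<close>.\<close>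
  let ?F = "\<lambda>y::real^2. (0 + 1 * of_real (y$1) + 0 * of_real (y$2)) ^ a *
     (0 + 0 * of_real (y$1) + 1 * of_real (y$2)) ^ b *
     (cis e * exp (Complex c d * of_real (ln (y \<bullet> y))))"
  fix x :: "real^2" assume "x \<noteq> 0"
  thus "complex_analytic_at ?F x"
    by (intro complex_analytic_at_mult complex_analytic_at_power complex_analytic_at_affine
        complex_analytic_at_const complex_analytic_at_norm_powr)
  have "cis e * exp (Complex c d * of_real (ln (x \<bullet> x))) =
      of_real ((x \<bullet> x) powr c) * cis (d * ln (x \<bullet> x) + e)"
    using \<open>x \<noteq> 0\<close> by (simp add: exp_eq_polar powr_def cis_mult mult_ac add_ac)
  hence "?F x = of_real ((x$1)^a * (x$2)^b * (x \<bullet> x) powr c) * cis (d * ln (x \<bullet> x) + e)"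
    by simp
  thus "Re (?F x) = swirl a b c d e x"
    by (simp only: swirl_def Re_complex_of_real Im_complex_of_real times_complex.sel cis.sel mult_zero_left diff_zero) 
qed

lemma spiral_homogeneous_eq_Re:
  assumes "spiral_homogeneous D f"
  shows "\<exists>F. (\<forall>x. x \<noteq> 0 \<longrightarrow> complex_analytic_at F x) \<and> (\<forall>y. y \<noteq> 0 \<longrightarrow> Re (F y) = f y)"
  using assms
proof induction
  case (swirl a b c d e)
  show ?case by (rule swirl_eq_Re)
next
  case (add f g)
  then obtain F G where "\<forall>x. x \<noteq> 0 \<longrightarrow> complex_analytic_at F x" "\<forall>y. y \<noteq> 0 \<longrightarrow> Re (F y) = f y"
    "\<forall>x. x \<noteq> 0 \<longrightarrow> complex_analytic_at G x" "\<forall>y. y \<noteq> 0 \<longrightarrow> Re (G y) = g y"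
    by (elim exE conjE)
  thus ?case
    by (intro exI[of _ "\<lambda>y. F y + G y"]) (simp add: complex_analytic_at_add)
next
  case (scale f k)
  then obtain F where "\<forall>x. x \<noteq> 0 \<longrightarrow> complex_analytic_at F x" "\<forall>y. y \<noteq> 0 \<longrightarrow> Re (F y) = f y"
    by (elim exE conjE)
  thus ?case
    by (intro exI[of _ "\<lambda>y. of_real k * F y"])
       (simp add: complex_analytic_at_mult complex_analytic_at_const)
qed

text \<open>Real parts may be taken term by term, since the monomials are real.\<close>

lemma spiral_homogeneous_real_analytic:
  assumes "spiral_homogeneous D f"
  shows "real_analytic_on f (UNIV - {0})"
  unfolding real_analytic_on_def
proof
  fix x :: "real^2" assume x: "x \<in> UNIV - {0}"
  obtain F where F: "\<forall>x. x \<noteq> 0 \<longrightarrow> complex_analytic_at F x" "\<forall>y. y \<noteq> 0 \<longrightarrow> Re (F y) = f y"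
    using spiral_homogeneous_eq_Re[OF assms] by (elim exE conjE)
  then obtain r a where r: "r > 0" "\<And>y. y \<in> ball x r \<Longrightarrow> double_series a (y$1 - x$1) (y$2 - x$2) (F y)"
    using x unfolding complex_analytic_at_def by blast
  show "\<exists>r>0. \<exists>a. \<forall>y\<in>ball x r.
       ((\<lambda>(m, n). a m n * (y $ 1 - x $ 1) ^ m * (y $ 2 - x $ 2) ^ n) has_sum f y) UNIV"
  \<comment> \<open>A radius of at most \<open>norm x\<close> keeps the origin out of the ball;
    \<open>f\<close> is known to be the real part of \<open>F\<close> only off the origin.\<close>
  proof (intro exI[of _ "min r (norm x)"] conjI exI[of _ "\<lambda>m n. Re (a m n)"] ballI)
    fix y assume y: "y \<in> ball x (min r (norm x))"
    hence "y \<noteq> 0" "y \<in> ball x r" by auto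
    from has_sum_Re[OF r(2)[OF this(2), unfolded double_series_def]] this(1)
    show "((\<lambda>(m, n). Re (a m n) * (y $ 1 - x $ 1) ^ m * (y $ 2 - x $ 2) ^ n) has_sum f y) UNIV"
      by (simp add: F(2) case_prod_unfold flip: of_real_power of_real_diff)
  qed (use r(1) x in auto)
qed

section \<open>The gradient system in polar coordinates\<close>

text \<open>A Gronwall argument for the squared distance \<open>w\<close>: its derivative is at most
  \<open>2 * L * w\<close> in absolute value, so \<open>w\<close> times a suitable exponential is
  monotone, and \<open>w\<close> vanishes at \<open>t0\<close>.\<close>

lemma vector_ode_unique:
  fixes \<gamma> \<delta> :: "real \<Rightarrow> 'a::real_inner" and F :: "'a \<Rightarrow> 'a"
  assumes lip: "\<And>R. \<exists>L. \<forall>x y. norm x \<le> R \<longrightarrow> norm y \<le> R \<longrightarrow> norm (F x - F y) \<le> L * norm (x - y)"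
    and K: "is_interval K" "t0 \<in> K" "t \<in> K"
    and \<gamma>: "\<And>s. s \<in> K \<Longrightarrow> (\<gamma> has_vector_derivative F (\<gamma> s)) (at s within K)"
    and \<delta>: "\<And>s. s \<in> K \<Longrightarrow> (\<delta> has_vector_derivative F (\<delta> s)) (at s within K)"
    and init: "\<gamma> t0 = \<delta> t0"
  shows "\<gamma> t = \<delta> t"
proof -
  define a where "a = min t0 t"
  define b where "b = max t0 t"
  have ab: "a \<le> b" by (simp add: a_def b_def)
  have sub: "{a..b} \<subseteq> K"
  proof
    fix s assume s: "s \<in> {a..b}"
    have "a \<in> K" "b \<in> K" using K by (simp_all add: a_def b_def min_def max_def)
    thus "s \<in> K" by (rule mem_is_interval_1_I[OF K(1)]) (use s in auto)
  qed
  have "continuous_on K \<gamma>" "continuous_on K \<delta>"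
    unfolding continuous_on_eq_continuous_within
    by (blast intro: has_vector_derivative_continuous \<gamma> \<delta>)+
  hence cont: "continuous_on {a..b} \<gamma>" "continuous_on {a..b} \<delta>"
    using sub continuous_on_subset by blast+
  obtain R1 where R1: "\<And>s. s \<in> {a..b} \<Longrightarrow> norm (\<gamma> s) \<le> R1"
    using compact_imp_bounded[OF compact_continuous_image[OF cont(1) compact_Icc]]
    unfolding bounded_iff by blast
  obtain R2 where R2: "\<And>s. s \<in> {a..b} \<Longrightarrow> norm (\<delta> s) \<le> R2"
    using compact_imp_bounded[OF compact_continuous_image[OF cont(2) compact_Icc]]
    unfolding bounded_iff by blast
  \<comment> \<open>Both curves are bounded on the compact segment, so a single Lipschitz constant
    serves there.\<close>
  obtain L where L: "\<And>x y. norm x \<le> max R1 R2 \<Longrightarrow> norm y \<le> max R1 R2 \<Longrightarrow>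
      norm (F x - F y) \<le> L * norm (x - y)"
    using lip by blast
  define w where "w = (\<lambda>s. (\<gamma> s - \<delta> s) \<bullet> (\<gamma> s - \<delta> s))"
  define w' where "w' = (\<lambda>s. 2 * ((\<gamma> s - \<delta> s) \<bullet> (F (\<gamma> s) - F (\<delta> s))))"
  have w0: "w s \<ge> 0" for s by (simp add: w_def)
  have cw: "continuous_on {a..b} w"
    unfolding w_def by (intro continuous_intros cont)
  have dw: "(w has_real_derivative w' s) (at s)" if "a < s" "s < b" for s
  proof -
    have at: "at s within {a..b} = at s"
      using that by (intro at_within_interior) simp
    have "s \<in> K" using sub that by auto
    from has_vector_derivative_within_subset[OF \<gamma>[OF this] sub] has_vector_derivative_within_subset[OF \<delta>[OF this] sub]
    have "((\<lambda>s. \<gamma> s - \<delta> s) has_vector_derivative F (\<gamma> s) - F (\<delta> s)) (at s)"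
      unfolding at by (rule has_vector_derivative_diff)
    hence "((\<lambda>s. \<gamma> s - \<delta> s) has_derivative (\<lambda>h. h *\<^sub>R (F (\<gamma> s) - F (\<delta> s)))) (at s)"
      unfolding has_vector_derivative_def .
    from has_derivative_inner[OF this this]
    show ?thesis unfolding w_def w'_def has_field_derivative_def
      by (rule has_derivative_eq_rhs) (simp add: fun_eq_iff inner_commute)
  qed
  have bound: "\<bar>w' s\<bar> \<le> 2 * L * w s" if "s \<in> {a..b}" for s
  proof -
    have "\<bar>(\<gamma> s - \<delta> s) \<bullet> (F (\<gamma> s) - F (\<delta> s))\<bar> \<le> norm (\<gamma> s - \<delta> s) * norm (F (\<gamma> s) - F (\<delta> s))"
      by (rule Cauchy_Schwarz_ineq2)
    also have "\<dots> \<le> norm (\<gamma> s - \<delta> s) * (L * norm (\<gamma> s - \<delta> s))"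
      using R1[OF that] R2[OF that] by (intro mult_left_mono L) auto
    also have "\<dots> = L * w s" by (simp add: w_def dot_square_norm power2_eq_square)
    finally show ?thesis by (simp add: w'_def abs_mult)
  qed
  have "w t0 = 0" using init by (simp add: w_def)
  have "w t \<le> 0"
  proof (cases "t0 \<le> t")
    case True
    hence e: "a = t0" "b = t" by (simp_all add: a_def b_def)
    \<comment> \<open>Forward in time \<open>w' \<le> 2 * L * w\<close> is used; in the other case
      it is \<open>w' \<ge> - (2 * L * w)\<close>.\<close>
    have "exp (- (2 * L * b)) * w b \<le> exp (- (2 * L * a)) * w a"
    proof (rule DERIV_nonpos_imp_decreasing_open[OF ab])
      fix s assume s: "a < s" "s < b"
      have "((\<lambda>s. exp (- (2 * L * s)) * w s) has_real_derivative
          exp (- (2 * L * s)) * (w' s - 2 * L * w s)) (at s)"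
        by (auto intro!: derivative_eq_intros dw s simp: algebra_simps)
      moreover have "exp (- (2 * L * s)) * (w' s - 2 * L * w s) \<le> 0"
        using bound[of s] s by (intro mult_nonneg_nonpos) auto
      ultimately show "\<exists>y. ((\<lambda>s. exp (- (2 * L * s)) * w s) has_real_derivative y) (at s) \<and> y \<le> 0"
        by blast
    qed (intro continuous_intros cw)
    thus ?thesis using \<open>w t0 = 0\<close> unfolding e by (simp add: mult_le_0_iff)
  next
    case False
    hence e: "a = t" "b = t0" by (simp_all add: a_def b_def)
    have "exp (2 * L * a) * w a \<le> exp (2 * L * b) * w b"
    proof (rule DERIV_nonneg_imp_increasing_open[OF ab])
      fix s assume s: "a < s" "s < b"
      have "((\<lambda>s. exp (2 * L * s) * w s) has_real_derivative
          exp (2 * L * s) * (w' s + 2 * L * w s)) (at s)"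
        by (auto intro!: derivative_eq_intros dw s simp: algebra_simps)
      moreover have "exp (2 * L * s) * (w' s + 2 * L * w s) \<ge> 0"
        using bound[of s] s by (intro mult_nonneg_nonneg) auto
      ultimately show "\<exists>y. ((\<lambda>s. exp (2 * L * s) * w s) has_real_derivative y) (at s) \<and> 0 \<le> y"
        by blast
    qed (intro continuous_intros cw)
    thus ?thesis using \<open>w t0 = 0\<close> unfolding e by (simp add: mult_le_0_iff)
  qed
  with w0[of t] have "w t = 0" by linarith
  thus ?thesis by (simp add: w_def)
qed

text \<open>Serves to turn time as a function of the phase into the phase as a function of time;
  \<open>L\<close> becomes the blow-up time. Strict monotonicity keeps the supremum from being
  attained, and the intermediate value theorem gives every value below it.\<close>

lemma real_inverse_onto_lessThan:
  fixes g g' :: "real \<Rightarrow> real"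
  assumes der: "\<And>u. (g has_real_derivative g' u) (at u)" and pos: "\<And>u. g' u > 0"
    and bdd: "bdd_above (range g)" and bot: "filterlim g at_bot at_bot"
  defines "L \<equiv> Sup (range g)"
  shows "\<exists>h. (\<forall>u. g u < L \<and> h (g u) = u) \<and>
    (\<forall>t<L. g (h t) = t \<and> (h has_real_derivative 1 / g' (h t)) (at t)) \<and>
    filterlim h at_bot at_bot \<and> filterlim h at_top (at_left L)"
proof -
  have mono: "g u < g v" if "u < v" for u v
    using DERIV_pos_imp_increasing[OF that] der pos by blast
  have inj: "g u < g v \<longleftrightarrow> u < v" for u v
    using mono[of u v] mono[of v u] by (cases u v rule: linorder_cases) auto
  have ub: "g u \<le> L" for u unfolding L_def by (intro cSup_upper bdd) auto
  have lt: "g u < L" for u using mono[of u "u+1"] ub[of "u+1"] by simp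
  have cont: "isCont g u" for u using der DERIV_isCont by blast
  have surj: "\<exists>u. g u = t" if t: "t < L" for t
  proof -
    obtain v where v: "t < g v" using t bdd unfolding L_def by (auto simp: less_cSup_iff)
    obtain u where u: "g u < t"
      using bot unfolding filterlim_at_bot_dense eventually_at_bot_linorder by blast
    have "u \<le> v" using u v inj[of u v] by linarith
    thus ?thesis using IVT[of g u t v] u v cont by auto
  qed
  define h where "h = (\<lambda>t. THE u. g u = t)"
  have hg: "h (g u) = u" for u unfolding h_def
  proof (rule the_equality)
    fix v assume "g v = g u"
    thus "v = u" using inj[of u v] inj[of v u] by linarith
  qed simp
  have gh: "g (h t) = t" if "t < L" for t using surj[OF that] hg by auto
  have ch: "isCont h t" if "t < L" for t
    using isCont_inverse_function2[of "h t - 1" "h t" "h t + 1" h g] hg gh[OF that] cont by auto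
  have dh: "(h has_real_derivative 1 / g' (h t)) (at t)" if "t < L" for t
    using DERIV_inverse_function[of g "g' (h t)" h t "t - 1" L] der pos[of "h t"] that gh ch
    by (simp add: inverse_eq_divide)
  have "filterlim h at_bot at_bot"
    unfolding filterlim_at_bot_dense
  proof
    fix Z
    show "\<forall>\<^sub>F x in at_bot. h x < Z"
      using eventually_gt_at_bot[of "g Z"]
    proof eventually_elim
      case (elim t)
      hence "t < L" using lt[of Z] by linarith
      thus ?case using elim inj[of "h t" Z] gh[of t] by simp
    qed
  qed
  moreover have "filterlim h at_top (at_left L)"
    unfolding filterlim_at_top_dense
  proof
    fix Z
    show "\<forall>\<^sub>F x in at_left L. Z < h x"
      using eventually_at_left_real[OF lt[of Z]]
    proof eventually_elim
      case (elim t)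
      thus ?case using inj[of Z "h t"] gh[of t] by simp
    qed
  qed
  ultimately show ?thesis using lt hg gh dh by (intro exI[of _ h]) auto
qed

lemma filterlim_affine_real:
  fixes a b :: real
  assumes "a > 0"
  shows "filterlim (\<lambda>u. a * u + b) at_top at_top" "filterlim (\<lambda>u. a * u + b) at_bot at_bot"
    "filterlim (\<lambda>u. b - a * u) at_top at_bot"
proof -
  show top: "filterlim (\<lambda>u. a * u + b) at_top at_top" for b
    unfolding filterlim_at_top
  proof
    fix Z show "\<forall>\<^sub>F u in at_top. Z \<le> a * u + b"
      using eventually_ge_at_top[of "(Z - b) / a"]
      by eventually_elim (use assms in \<open>simp add: field_simps\<close>)
  qed
  show "filterlim (\<lambda>u. b - a * u) at_top at_bot"
    using top[of b] by (simp add: filterlim_at_bot_mirror add.commute)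
  thus "filterlim (\<lambda>u. a * u + b) at_bot at_bot"
    using top[of "- b"] by (simp add: filterlim_at_bot_mirror filterlim_uminus_at_bot)
qed

section \<open>The system for the logarithmic radius and the phase\<close>

text \<open>\<open>p\<close> is the degree of the potential and \<open>\<epsilon>\<close> the size
  of the perturbation. The bounds keep \<open>M\<close> and \<open>N\<close> comparable to
  \<open>p\<close>, and \<open>p \<ge> 4\<close> yields \<open>M u \<ge> 2\<close> for the
  Lojasiewicz inequality.\<close>

locale spiral_system =
  fixes p \<epsilon> :: real
  assumes p: "p \<ge> 4" and \<epsilon>: "0 < \<epsilon>" "\<epsilon> \<le> 1/4"
begin

definition "M u = p * (1 + \<epsilon> * cos u) - \<epsilon> * sin u"

text \<open>The difference \<open>M u - N u = \<epsilon> * sin u\<close> is the corresponding factor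
  for the polar angle, which is the logarithmic radius minus the phase.\<close>

definition "N u = p * (1 + \<epsilon> * cos u) - 2 * \<epsilon> * sin u"

lemma eps_bounds: "\<bar>\<epsilon> * cos u\<bar> \<le> 1/4" "\<bar>\<epsilon> * sin u\<bar> \<le> 1/4"
proof -
  have "\<bar>\<epsilon>\<bar> * \<bar>cos u\<bar> \<le> 1/4 * 1" "\<bar>\<epsilon>\<bar> * \<bar>sin u\<bar> \<le> 1/4 * 1"
    using \<epsilon> by (intro mult_mono; simp)+
  thus "\<bar>\<epsilon> * cos u\<bar> \<le> 1/4" "\<bar>\<epsilon> * sin u\<bar> \<le> 1/4" by (simp_all add: abs_mult)
qed

lemma M_ge: "M u \<ge> p / 2" and N_ge: "N u \<ge> p / 2" and N_le: "N u \<le> 2 * p"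
proof -
  have "\<bar>p * (\<epsilon> * cos u)\<bar> \<le> p * (1/4)"
    using eps_bounds(1)[of u] p by (simp add: abs_mult)
  thus "M u \<ge> p / 2" "N u \<ge> p / 2" "N u \<le> 2 * p"
    using p eps_bounds(2)[of u] unfolding M_def N_def by (auto simp: distrib_left abs_le_iff)
qed

lemma N_pos: "N u > 0" using N_ge[of u] p by linarith

text \<open>Makes the logarithmic radius grow at least linearly in the phase.\<close>

lemma M_div_N_ge: "M u / N u \<ge> 1/4"
proof -
  have "1/4 * N u \<le> M u" using M_ge[of u] N_le[of u] by linarith
  thus ?thesis using N_pos[of u] by (simp add: pos_le_divide_eq)
qed

lemma isCont_MN: "isCont M u" "isCont N u"
  unfolding M_def[abs_def] N_def[abs_def] by (intro continuous_intros)+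

text \<open>The solution with the angle \<open>u = ln r - \<theta>\<close> as independent variable: \<open>S\<close> is \<open>ln r\<close>
  and \<open>S u - u\<close> is the polar angle.\<close>
lemma log_radius_exists:
  "\<exists>S. S u0 = s0 \<and> (\<forall>u. (S has_real_derivative M u / N u) (at u)) \<and>
     filterlim S at_bot at_bot \<and> filterlim S at_top at_top \<and>
     filterlim (\<lambda>u. \<bar>S u - u\<bar>) at_top at_bot \<and> filterlim (\<lambda>u. \<bar>S u - u\<bar>) at_top at_top \<and>
     (\<forall>u\<ge>u0. S u \<ge> s0 + (u - u0) / 4) \<and> (\<forall>u\<le>u0. S u \<le> s0 + (u - u0) / 4)"
proof -
  have "isCont (\<lambda>u. M u / N u) u" for u
    using isCont_MN N_pos[of u] by (intro continuous_intros) auto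
  then obtain S0 where S0: "\<And>u. (S0 has_vector_derivative M u / N u) (at u)"
    using einterval_antiderivative[of "-\<infinity>" \<infinity> "\<lambda>u. M u / N u"] by auto
  define S where "S = (\<lambda>u. S0 u - S0 u0 + s0)"
  have dS: "(S has_real_derivative M u / N u) (at u)" for u
    unfolding S_def using S0[of u, folded has_real_derivative_iff_has_vector_derivative]
    by (auto intro!: derivative_eq_intros)
  have [simp]: "S u0 = s0" by (simp add: S_def)
  \<comment> \<open>Comparison with a line of slope \<open>1/4\<close> through
    \<open>(u0, s0)\<close>: \<open>S\<close> lies above it to the right and below it to the
    left.\<close>
  have inc: "S v - v / 4 \<ge> S u - u / 4" if "u \<le> v" for u v
  proof (rule DERIV_nonneg_imp_nondecreasing[OF that])
    fix x
    have "((\<lambda>u. S u - u / 4) has_real_derivative M x / N x - 1/4) (at x)"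
      by (auto intro!: derivative_eq_intros dS)
    thus "\<exists>y. ((\<lambda>u. S u - u / 4) has_real_derivative y) (at x) \<and> 0 \<le> y"
      using M_div_N_ge[of x] by (intro exI[of _ "M x / N x - 1/4"]) simp
  qed
  have up: "S u \<ge> s0 + (u - u0) / 4" if "u \<ge> u0" for u
    using inc[OF that] by (simp add: diff_divide_distrib)
  have dn: "S u \<le> s0 + (u - u0) / 4" if "u \<le> u0" for u
    using inc[OF that] by (simp add: diff_divide_distrib)
  have top: "filterlim S at_top at_top"
  proof (rule filterlim_at_top_mono)
    show "filterlim (\<lambda>u. s0 + (u - u0) / 4) at_top at_top"
      using filterlim_affine_real(1)[of "1/4" "s0 - u0 / 4"] by (simp add: algebra_simps diff_divide_distrib)
    show "\<forall>\<^sub>F u in at_top. s0 + (u - u0) / 4 \<le> S u"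
      using eventually_ge_at_top[of u0] by eventually_elim (rule up)
  qed
  have bot: "filterlim S at_bot at_bot"
  proof (rule filterlim_at_bot_mono)
    show "filterlim (\<lambda>u. s0 + (u - u0) / 4) at_bot at_bot"
      using filterlim_affine_real(2)[of "1/4" "s0 - u0 / 4"] by (simp add: algebra_simps diff_divide_distrib)
    show "\<forall>\<^sub>F u in at_bot. S u \<le> s0 + (u - u0) / 4"
      using eventually_le_at_bot[of u0] by eventually_elim (rule dn)
  qed
  \<comment> \<open>Chosen so that \<open>2 * \<epsilon>\<^sup>2 * (sin x)\<^sup>2 / (N x * G x)
    \<ge> c * (sin x)\<^sup>2\<close>, by \<open>N x \<le> 2 * p\<close> and
    \<open>G x \<le> 2\<close>.\<close>
  define c where "c = \<epsilon>\<^sup>2 / (2 * p)"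
  have c: "c > 0" using \<epsilon> p by (simp add: c_def)
  define G where "G = (\<lambda>u. 1 + \<epsilon> * cos u)"
  have G: "G u > 0" "G u \<le> 2" "3/4 \<le> G u" for u using eps_bounds(1)[of u] by (auto simp: G_def)
  \<comment> \<open>\<open>u / 2 - sin (2 * u) / 4\<close> is an antiderivative of
    \<open>(sin u)\<^sup>2\<close>. Monotonicity of \<open>W\<close> therefore compares the angle,
    up to bounded terms, with the linear drift \<open>c / 2 * u\<close>.\<close>
  define W where "W = (\<lambda>u. p * (S u - u) + ln (G u) - c * (u / 2 - sin (2 * u) / 4))"
  have W: "W u \<le> W v" if "u \<le> v" for u v
  proof (rule DERIV_nonneg_imp_nondecreasing[OF that])
    fix x
    have NG: "N x = p * G x - 2 * \<epsilon> * sin x" "M x = N x + \<epsilon> * sin x"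
      by (simp_all add: N_def M_def G_def)
    have s2: "1/2 - cos (2 * x) / 2 = (sin x)\<^sup>2" by (simp add: cos_double_sin diff_divide_distrib)
    have "(W has_real_derivative p * (M x / N x - 1) - \<epsilon> * sin x / G x - c * (1/2 - cos (2 * x) / 2)) (at x)"
      unfolding W_def using G[of x] unfolding G_def
      by (auto intro!: derivative_eq_intros dS simp: field_simps)
    also have "p * (M x / N x - 1) - \<epsilon> * sin x / G x = 2 * \<epsilon>\<^sup>2 * (sin x)\<^sup>2 / (N x * G x)"
    proof -
      have "M x / N x - 1 = \<epsilon> * sin x / N x" using N_pos[of x] NG(2) by (simp add: field_simps)
      hence "p * (M x / N x - 1) - \<epsilon> * sin x / G x = \<epsilon> * sin x * (p * G x - N x) / (N x * G x)"
        using N_pos[of x] G(1)[of x] by (simp add: field_simps)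
      thus ?thesis by (simp add: NG(1) power2_eq_square ac_simps)
    qed
    finally have d: "(W has_real_derivative 2 * \<epsilon>\<^sup>2 * (sin x)\<^sup>2 / (N x * G x) - c * (sin x)\<^sup>2) (at x)"
      unfolding s2 .
    have "N x * G x \<le> (2 * p) * 2"
      using N_le[of x] G[of x] N_pos[of x] p by (intro mult_mono) auto
    hence "2 * \<epsilon>\<^sup>2 * (sin x)\<^sup>2 / (N x * G x) \<ge> 2 * \<epsilon>\<^sup>2 * (sin x)\<^sup>2 / ((2 * p) * 2)"
      using N_pos[of x] G(1)[of x] p by (intro divide_left_mono) auto
    hence "2 * \<epsilon>\<^sup>2 * (sin x)\<^sup>2 / (N x * G x) \<ge> c * (sin x)\<^sup>2" by (simp add: c_def)
    with d show "\<exists>y. (W has_real_derivative y) (at x) \<and> 0 \<le> y" by force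
  qed
  \<comment> \<open>Collects the bounded terms: \<open>ln (G u)\<close>, the value
    \<open>W u0\<close> and the oscillating sine.\<close>
  define K where "K = ln 2 - ln (3/4) + \<bar>W u0\<bar> + c"
  have lnG: "\<bar>ln (G u)\<bar> \<le> ln 2 - ln (3/4)" for u
  proof -
    have "ln (G u) \<le> ln 2" "ln (3/4) \<le> ln (G u)" "ln (3/4) \<le> (0::real)" "0 \<le> ln (2::real)"
      using G[of u] by auto
    thus ?thesis by linarith
  qed
  have sb: "\<bar>c * (sin (2 * u) / 4)\<bar> \<le> c" for u
    using c mult_left_mono[of "\<bar>sin (2*u)\<bar>" 4 c] order.trans[OF abs_sin_le_one] by (simp add: abs_mult)
  have W_eq: "W u = p * (S u - u) + ln (G u) - (c / 2 * u - c * (sin (2 * u) / 4))" for u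
    by (simp add: W_def right_diff_distrib)
  have up': "p * (S u - u) \<ge> c / 2 * u - K" if "u \<ge> u0" for u
    using W[OF that] lnG[of u] sb[of u] W_eq[of u] unfolding K_def by linarith
  have dn': "p * (S u - u) \<le> c / 2 * u + K" if "u \<le> u0" for u
    using W[OF that] lnG[of u] sb[of u] W_eq[of u] unfolding K_def by linarith
  have "filterlim (\<lambda>u. \<bar>S u - u\<bar>) at_top at_top"
  proof (rule filterlim_at_top_mono)
    show "filterlim (\<lambda>u. (c / 2 * u - K) / p) at_top at_top"
      using filterlim_affine_real(1)[of "c / 2 / p" "- K / p"] c p by (simp add: diff_divide_distrib)
    show "\<forall>\<^sub>F u in at_top. (c / 2 * u - K) / p \<le> \<bar>S u - u\<bar>"
      using eventually_ge_at_top[of u0]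
    proof eventually_elim
      case (elim u)
      have "(c / 2 * u - K) / p \<le> S u - u" using up'[OF elim] p by (simp add: field_simps)
      thus ?case by linarith
    qed
  qed
  moreover have "filterlim (\<lambda>u. \<bar>S u - u\<bar>) at_top at_bot"
  proof (rule filterlim_at_top_mono)
    have "(\<lambda>u. (- (c / 2 * u) - K) / p) = (\<lambda>u. - K / p - c / 2 / p * u)"
      using p by (simp add: fun_eq_iff field_simps)
    thus "filterlim (\<lambda>u. (- (c / 2 * u) - K) / p) at_top at_bot"
      using filterlim_affine_real(3)[of "c / 2 / p" "- K / p"] c p by simp
    show "\<forall>\<^sub>F u in at_bot. (- (c / 2 * u) - K) / p \<le> \<bar>S u - u\<bar>"
      using eventually_le_at_bot[of u0]
    proof eventually_elim
      case (elim u)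
      have "(- (c / 2 * u) - K) / p \<le> - (S u - u)" using dn'[OF elim] p by (simp add: field_simps)
      thus ?case by linarith
    qed
  qed
  ultimately show ?thesis using dS top bot up dn by (intro exI[of _ S]) auto
qed

text \<open>Along the curve of \<open>log_radius_exists\<close> time is the integral of
  \<open>exp (- (p - 2) * S u) / N u\<close>. Inverting it makes time the independent variable;
  \<open>T\<close> is the supremum of the times reached.\<close>

lemma polar_solution_exists:
  "\<exists>T>0. \<exists>\<rho> \<psi>. \<rho> 0 = s0 \<and> \<psi> 0 = u0 \<and>
     (\<forall>t<T. (\<rho> has_real_derivative exp ((p - 2) * \<rho> t) * M (\<psi> t)) (at t) \<and>
            (\<psi> has_real_derivative exp ((p - 2) * \<rho> t) * N (\<psi> t)) (at t)) \<and>
     filterlim \<rho> at_bot at_bot \<and> filterlim \<rho> at_top (at_left T) \<and>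
     filterlim (\<lambda>t. \<bar>\<rho> t - \<psi> t\<bar>) at_top at_bot \<and> filterlim (\<lambda>t. \<bar>\<rho> t - \<psi> t\<bar>) at_top (at_left T)"
proof -
  obtain S where S: "S u0 = s0" "\<And>u. (S has_real_derivative M u / N u) (at u)"
     "filterlim S at_bot at_bot" "filterlim S at_top at_top"
     "filterlim (\<lambda>u. \<bar>S u - u\<bar>) at_top at_bot" "filterlim (\<lambda>u. \<bar>S u - u\<bar>) at_top at_top"
     "\<And>u. u \<ge> u0 \<Longrightarrow> S u \<ge> s0 + (u - u0) / 4" "\<And>u. u \<le> u0 \<Longrightarrow> S u \<le> s0 + (u - u0) / 4"
    using log_radius_exists[of u0 s0] by blast
  define n where "n = p - 2"
  have n: "n > 0" using p by (simp add: n_def)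
  define g' where "g' = (\<lambda>u. exp (- n * S u) / N u)"
  have g'pos: "g' u > 0" for u using N_pos by (simp add: g'_def)
  have "isCont g' u" for u
    unfolding g'_def using isCont_MN N_pos[of u] DERIV_isCont[OF S(2)] by (intro continuous_intros) auto
  then obtain g0 where g0: "\<And>u. (g0 has_vector_derivative g' u) (at u)"
    using einterval_antiderivative[of "-\<infinity>" \<infinity> g'] by auto
  define g where "g = (\<lambda>u. g0 u - g0 u0)"
  have dg: "(g has_real_derivative g' u) (at u)" for u
    unfolding g_def using g0[of u, folded has_real_derivative_iff_has_vector_derivative]
    by (auto intro!: derivative_eq_intros)
  have [simp]: "g u0 = 0" by (simp add: g_def)
  have mono: "g u \<le> g v" if "u \<le> v" for u v
    using that by (rule DERIV_nonneg_imp_nondecreasing) (use dg g'pos less_imp_le in blast)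
  \<comment> \<open>Minus an antiderivative of \<open>exp (- n * (s0 + (u - u0) / 4))\<close>, which
    dominates \<open>g'\<close> to the right of \<open>u0\<close>, as \<open>N u \<ge> 1\<close> and
    \<open>S\<close> stays above the line of slope \<open>1/4\<close>. So \<open>g + E\<close> is
    nonincreasing there.\<close>
  define E where "E = (\<lambda>u. 4 / n * exp (- n * (s0 + (u - u0) / 4)))"
  have upper: "g u \<le> 4 / n * exp (- n * s0)" if "u \<ge> u0" for u
  proof -
    have "g u + E u \<le> g u0 + E u0"
    proof (rule DERIV_nonpos_imp_nonincreasing[OF that])
      fix x assume x: "u0 \<le> x" "x \<le> u"
      have "((\<lambda>u. g u + E u) has_real_derivative g' x - exp (- n * (s0 + (x - u0) / 4))) (at x)"
        unfolding E_def using n by (auto intro!: derivative_eq_intros dg)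
      moreover have "g' x \<le> exp (- n * (s0 + (x - u0) / 4))"
      proof -
        have "g' x \<le> exp (- n * S x) / 1"
          unfolding g'_def using N_ge[of x] N_pos[of x] p by (intro divide_left_mono) auto
        also have "\<dots> \<le> exp (- n * (s0 + (x - u0) / 4))"
          using S(7)[OF x(1)] n by simp
        finally show ?thesis .
      qed
      ultimately show "\<exists>y. ((\<lambda>u. g u + E u) has_real_derivative y) (at x) \<and> y \<le> 0" by force
    qed
    moreover have "E u \<ge> 0" using n by (simp add: E_def)
    ultimately show ?thesis by (simp add: E_def)
  qed
  have bdd: "bdd_above (range g)"
  proof (rule bdd_aboveI2)
    fix u
    show "g u \<le> 4 / n * exp (- n * s0)"
    proof (cases "u \<ge> u0")
      case False
      hence "g u \<le> 0" using mono[of u u0] by simp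
      also have "\<dots> \<le> 4 / n * exp (- n * s0)" using n by simp
      finally show ?thesis .
    qed (rule upper)
  qed
  \<comment> \<open>A lower bound of \<open>g'\<close> to the left of \<open>u0\<close>, where
    \<open>S u \<le> s0\<close> and \<open>N u \<le> 2 * p\<close>; hence time runs back to minus
    infinity.\<close>
  define k where "k = exp (- n * s0) / (2 * p)"
  have k: "k > 0" using p by (simp add: k_def)
  have lower: "g u \<le> k * (u - u0)" if "u \<le> u0" for u
  proof -
    have "g u - k * u \<le> g u0 - k * u0"
    proof (rule DERIV_nonneg_imp_nondecreasing[OF that])
      fix x assume x: "u \<le> x" "x \<le> u0"
      have "((\<lambda>u. g u - k * u) has_real_derivative g' x - k) (at x)"
        by (auto intro!: derivative_eq_intros dg)
      moreover have "k \<le> g' x"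
      proof -
        have "(x - u0) / 4 \<le> 0" using x(2) by simp
        hence "S x \<le> s0" using S(8)[OF x(2)] by linarith
        hence "exp (- n * s0) \<le> exp (- n * S x)" using n by simp
        thus ?thesis unfolding k_def g'_def using N_pos[of x] N_le[of x] by (intro frac_le) auto
      qed
      ultimately show "\<exists>y. ((\<lambda>u. g u - k * u) has_real_derivative y) (at x) \<and> 0 \<le> y" by force
    qed
    thus ?thesis by (simp add: algebra_simps)
  qed
  have bot: "filterlim g at_bot at_bot"
  proof (rule filterlim_at_bot_mono)
    show "filterlim (\<lambda>u. k * (u - u0)) at_bot at_bot"
      using filterlim_affine_real(2)[OF k, of "- k * u0"] by (simp add: right_diff_distrib)
    show "\<forall>\<^sub>F u in at_bot. g u \<le> k * (u - u0)"
      using eventually_le_at_bot[of u0] by eventually_elim (rule lower)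
  qed
  define T where "T = Sup (range g)"
  obtain h where h: "\<And>u. g u < T" "\<And>u. h (g u) = u" "\<And>t. t < T \<Longrightarrow> g (h t) = t"
    "\<And>t. t < T \<Longrightarrow> (h has_real_derivative 1 / g' (h t)) (at t)"
    "filterlim h at_bot at_bot" "filterlim h at_top (at_left T)"
    using real_inverse_onto_lessThan[OF dg g'pos bdd bot, folded T_def] by blast
  have T: "T > 0" using h(1)[of u0] by simp
  have [simp]: "h 0 = u0" using h(2)[of u0] by simp
  \<comment> \<open>The derivative \<open>1 / g'\<close> of the inverse function is the required
    velocity of the phase; in the chain rule for \<open>S\<close> the factor \<open>N\<close> then
    cancels.\<close>
  have d\<psi>: "(h has_real_derivative exp (n * S (h t)) * N (h t)) (at t)" if "t < T" for t
    using h(4)[OF that] by (simp add: g'_def exp_minus field_simps)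
  have d\<rho>: "((\<lambda>t. S (h t)) has_real_derivative exp (n * S (h t)) * M (h t)) (at t)" if "t < T" for t
    using DERIV_chain2[OF S(2) d\<psi>[OF that]] N_pos[of "h t"] by (simp add: field_simps)
  show ?thesis
  proof (rule exI[of _ T], rule conjI[OF T], rule exI[of _ "\<lambda>t. S (h t)"], rule exI[of _ h],
      intro conjI allI impI)
    show "filterlim (\<lambda>t. S (h t)) at_bot at_bot" by (rule filterlim_compose[OF S(3) h(5)])
    show "filterlim (\<lambda>t. S (h t)) at_top (at_left T)" by (rule filterlim_compose[OF S(4) h(6)])
    show "filterlim (\<lambda>t. \<bar>S (h t) - h t\<bar>) at_top at_bot" by (rule filterlim_compose[OF S(5) h(5)])
    show "filterlim (\<lambda>t. \<bar>S (h t) - h t\<bar>) at_top (at_left T)" by (rule filterlim_compose[OF S(6) h(6)])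
  qed (use S(1) d\<psi> d\<rho> n_def in auto)
qed

end

section \<open>The potential and its gradient orbits\<close>

text \<open>With the logarithm of the radius as coordinate, the phase is
  \<open>\<rho> - \<theta>\<close> and the origin is never a value.\<close>

definition log_polar :: "real \<Rightarrow> real \<Rightarrow> real^2" where
  "log_polar \<rho> \<theta> = vector [exp \<rho> * cos \<theta>, exp \<rho> * sin \<theta>]"

lemma log_polar_nth [simp]: "log_polar \<rho> \<theta> $ 1 = exp \<rho> * cos \<theta>" "log_polar \<rho> \<theta> $ 2 = exp \<rho> * sin \<theta>"
  by (simp_all add: log_polar_def)

lemma inner_log_polar: "log_polar \<rho> \<theta> \<bullet> log_polar \<rho> \<theta> = exp (2 * \<rho>)"
proof -
  have "log_polar \<rho> \<theta> \<bullet> log_polar \<rho> \<theta> = exp \<rho> * exp \<rho> * ((cos \<theta>)\<^sup>2 + (sin \<theta>)\<^sup>2)"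
    by (simp only: inner_real2 log_polar_nth) algebra
  thus ?thesis by (simp flip: exp_add)
qed

lemma norm_log_polar [simp]: "norm (log_polar \<rho> \<theta>) = exp \<rho>"
  by (simp add: norm_eq_sqrt_inner inner_log_polar exp_double[of \<rho>] real_sqrt_unique)

lemma log_polar_exists:
  assumes "(x::real^2) \<noteq> 0"
  shows "\<exists>\<rho> \<theta>. x = log_polar \<rho> \<theta>"
proof -
  define r where "r = norm x"
  have r: "r > 0" using assms by (simp add: r_def)
  have "(x$1)\<^sup>2 + (x$2)\<^sup>2 = r\<^sup>2" by (simp add: r_def norm_real2_sq)
  hence "(x$1 / r)\<^sup>2 + (x$2 / r)\<^sup>2 = 1" using r by (simp add: power_divide flip: add_divide_distrib)
  then obtain \<theta> where "x$1 / r = cos \<theta>" "x$2 / r = sin \<theta>" using sincos_total_2pi by metis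
  hence "x = log_polar (ln r) \<theta>" using r by (simp add: vec_eq_iff forall_2 field_simps)
  thus ?thesis by blast
qed

text \<open>The degree becomes the rate of an exponential, and the phase becomes linear in
  \<open>\<rho>\<close> since \<open>ln (x \<bullet> x) = 2 * \<rho>\<close>.\<close>

lemma swirl_log_polar:
  "swirl a b c d e (log_polar \<rho> \<theta>) =
     exp ((real a + real b + 2 * c) * \<rho>) * cos \<theta> ^ a * sin \<theta> ^ b * cos (2 * d * \<rho> + e)"
proof -
  have "exp (2 * \<rho>) powr c = exp (2 * c * \<rho>)" by (simp add: powr_def ac_simps)
  moreover have "exp \<rho> ^ a * exp \<rho> ^ b * exp (2 * c * \<rho>) = exp ((real a + real b + 2 * c) * \<rho>)"
    by (simp add: exp_add distrib_right exp_of_nat_mult)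
  ultimately show ?thesis
    by (simp add: swirl_def inner_log_polar power_mult_distrib ac_simps)
qed

section \<open>The potential and its gradient\<close>

text \<open>This is \<open>r powr (2 * q) * cos (ln r - \<theta>)\<close>, expanded by the addition
  formula. The coordinates contribute \<open>r * cos \<theta>\<close> and
  \<open>r * sin \<theta>\<close>, so the exponent \<open>q - 1/2\<close> gives degree
  \<open>2 * q\<close>; the frequency \<open>1/2\<close> turns \<open>ln (x \<bullet> x)\<close>
  into \<open>ln r\<close>, and the phase \<open>- pi / 2\<close> turns the cosine into a
  sine.\<close>

definition spiral_wave :: "real \<Rightarrow> real^2 \<Rightarrow> real" where
  "spiral_wave q x = swirl 1 0 (q - 1/2) (1/2) 0 x + swirl 0 1 (q - 1/2) (1/2) (- pi / 2) x"

text \<open>The parameter \<open>q\<close> is half the degree, as powers are taken of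
  \<open>x \<bullet> x\<close>.\<close>

definition spiral_potential :: "real \<Rightarrow> real \<Rightarrow> real^2 \<Rightarrow> real" where
  "spiral_potential q \<epsilon> x = swirl 0 0 q 0 0 x + \<epsilon> * spiral_wave q x"

lemma spiral_homogeneous_wave: "spiral_homogeneous (2 * q) (spiral_wave q)"
  unfolding spiral_wave_def[abs_def] by (intro spiral_homogeneous.add spiral_homogeneous.swirl) simp_all

lemma spiral_homogeneous_potential: "spiral_homogeneous (2 * q) (spiral_potential q \<epsilon>)"
  unfolding spiral_potential_def[abs_def]
  by (rule spiral_homogeneous.add[OF spiral_homogeneous.swirl
        spiral_homogeneous.scale[OF spiral_homogeneous_wave]]) simp

lemma cos_minus_pi_half: "cos (x - pi / 2) = sin x" "cos (x + - pi / 2) = sin x"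
  by (simp_all add: cos_diff)

lemma spiral_potential_log_polar:
  "spiral_potential q \<epsilon> (log_polar \<rho> \<theta>) = exp (2 * q * \<rho>) * (1 + \<epsilon> * cos (\<rho> - \<theta>))"
  by (simp add: spiral_potential_def spiral_wave_def swirl_log_polar cos_minus_pi_half cos_diff algebra_simps)

definition spiral_gradient :: "real \<Rightarrow> real \<Rightarrow> real^2 \<Rightarrow> real^2" where
  "spiral_gradient q \<epsilon> x = vector [
     swirl1 0 0 q 0 0 x + \<epsilon> * (swirl1 1 0 (q - 1/2) (1/2) 0 x + swirl1 0 1 (q - 1/2) (1/2) (- pi / 2) x),
     swirl2 0 0 q 0 0 x + \<epsilon> * (swirl2 1 0 (q - 1/2) (1/2) 0 x + swirl2 0 1 (q - 1/2) (1/2) (- pi / 2) x)]"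

lemma spiral_potential_GDERIV:
  assumes "q > 1/2"
  shows "GDERIV (spiral_potential q \<epsilon>) x :> spiral_gradient q \<epsilon> x"
  unfolding gderiv_def spiral_potential_def[abs_def] spiral_wave_def[abs_def]
proof (rule has_derivative_eq_rhs)
  show "((\<lambda>x. swirl 0 0 q 0 0 x + \<epsilon> * (swirl 1 0 (q - 1/2) (1/2) 0 x + swirl 0 1 (q - 1/2) (1/2) (- pi / 2) x))
    has_derivative (\<lambda>h. (h$1 * swirl1 0 0 q 0 0 x + h$2 * swirl2 0 0 q 0 0 x) +
      \<epsilon> * ((h$1 * swirl1 1 0 (q - 1/2) (1/2) 0 x + h$2 * swirl2 1 0 (q - 1/2) (1/2) 0 x) +
        (h$1 * swirl1 0 1 (q - 1/2) (1/2) (- pi / 2) x + h$2 * swirl2 0 1 (q - 1/2) (1/2) (- pi / 2) x)))) (at x)"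
    using assms by (intro has_derivative_add has_derivative_mult_right swirl_has_derivative) auto
qed (simp add: fun_eq_iff inner_real2 spiral_gradient_def algebra_simps)

text \<open>The radial and tangential components are the derivatives of \<open>exp (p * \<rho>) * (1
  + \<epsilon> * cos (\<rho> - \<theta>))\<close> in \<open>\<rho>\<close> and
  \<open>\<theta>\<close>, divided by the radius \<open>exp \<rho>\<close>. The proof verifies this
  on the Cartesian partial derivatives.\<close>

lemma spiral_gradient_log_polar:
  fixes p \<epsilon> \<rho> \<theta> q
  defines "\<psi> \<equiv> \<rho> - \<theta>"
  assumes p: "p = 2 * q"
  shows "spiral_gradient q \<epsilon> (log_polar \<rho> \<theta>) = exp ((p - 1) * \<rho>) *\<^sub>R
    vector [(p * (1 + \<epsilon> * cos \<psi>) - \<epsilon> * sin \<psi>) * cos \<theta> - \<epsilon> * sin \<psi> * sin \<theta>,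
            (p * (1 + \<epsilon> * cos \<psi>) - \<epsilon> * sin \<psi>) * sin \<theta> + \<epsilon> * sin \<psi> * cos \<theta>]"
proof -
  have c: "cos (\<rho> + pi / 2) = - sin \<rho>" by (simp add: cos_add)
  have \<rho>: "\<rho> = \<psi> + \<theta>" by (simp add: \<psi>_def)
  have cr: "cos \<rho> = cos \<psi> * cos \<theta> - sin \<psi> * sin \<theta>" "sin \<rho> = sin \<psi> * cos \<theta> + cos \<psi> * sin \<theta>"
    unfolding \<rho> by (simp_all add: cos_add sin_add)
  have ss: "sin \<theta> * sin \<theta> = 1 - cos \<theta> * cos \<theta>"
    using sin_cos_squared_add[of \<theta>] by (simp add: power2_eq_square)
  define X where "X = exp ((p - 1) * \<rho>)"
  have "swirl1 0 0 q 0 0 (log_polar \<rho> \<theta>) = X * (p * cos \<theta>)"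
    by (simp add: swirl1_def swirl_log_polar p X_def algebra_simps)
  moreover have "swirl2 0 0 q 0 0 (log_polar \<rho> \<theta>) = X * (p * sin \<theta>)"
    by (simp add: swirl2_def swirl_log_polar p X_def algebra_simps)
  moreover have "swirl1 1 0 (q - 1/2) (1/2) 0 (log_polar \<rho> \<theta>) =
      X * (cos \<rho> + (p - 1) * (cos \<theta>)\<^sup>2 * cos \<rho> - (cos \<theta>)\<^sup>2 * sin \<rho>)"
    by (simp add: swirl1_def swirl_log_polar p X_def c algebra_simps power2_eq_square)
  moreover have "swirl1 0 1 (q - 1/2) (1/2) (- pi / 2) (log_polar \<rho> \<theta>) =
      X * ((p - 1) * cos \<theta> * sin \<theta> * sin \<rho> + cos \<theta> * sin \<theta> * cos \<rho>)"
    by (simp add: swirl1_def swirl_log_polar p X_def cos_minus_pi_half algebra_simps power2_eq_square)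
  moreover have "swirl2 1 0 (q - 1/2) (1/2) 0 (log_polar \<rho> \<theta>) =
      X * ((p - 1) * cos \<theta> * sin \<theta> * cos \<rho> - cos \<theta> * sin \<theta> * sin \<rho>)"
    by (simp add: swirl2_def swirl_log_polar p X_def c algebra_simps power2_eq_square)
  moreover have "swirl2 0 1 (q - 1/2) (1/2) (- pi / 2) (log_polar \<rho> \<theta>) =
      X * (sin \<rho> + (p - 1) * (sin \<theta>)\<^sup>2 * sin \<rho> + (sin \<theta>)\<^sup>2 * cos \<rho>)"
    by (simp add: swirl2_def swirl_log_polar p X_def cos_minus_pi_half algebra_simps power2_eq_square)
  \<comment> \<open>After expanding \<open>\<rho> = \<psi> + \<theta>\<close> by \<open>cr\<close>,
    a polynomial identity in sines and cosines modulo \<open>ss\<close> remains.\<close>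
  moreover have 1: "p * cos \<theta> + \<epsilon> * (cos \<rho> + (p - 1) * (cos \<theta>)\<^sup>2 * cos \<rho> - (cos \<theta>)\<^sup>2 * sin \<rho> +
      ((p - 1) * cos \<theta> * sin \<theta> * sin \<rho> + cos \<theta> * sin \<theta> * cos \<rho>)) =
      (p * (1 + \<epsilon> * cos \<psi>) - \<epsilon> * sin \<psi>) * cos \<theta> - \<epsilon> * sin \<psi> * sin \<theta>"
    using ss unfolding cr power2_eq_square by algebra
  moreover have 2: "p * sin \<theta> + \<epsilon> * ((p - 1) * cos \<theta> * sin \<theta> * cos \<rho> - cos \<theta> * sin \<theta> * sin \<rho> +
      (sin \<rho> + (p - 1) * (sin \<theta>)\<^sup>2 * sin \<rho> + (sin \<theta>)\<^sup>2 * cos \<rho>)) =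
      (p * (1 + \<epsilon> * cos \<psi>) - \<epsilon> * sin \<psi>) * sin \<theta> + \<epsilon> * sin \<psi> * cos \<theta>"
    using ss unfolding cr power2_eq_square by algebra
  ultimately show ?thesis
    unfolding vec_eq_iff forall_2 spiral_gradient_def vector_2 vector_scaleR_component real_scaleR_def X_def[symmetric]
      1[symmetric] 2[symmetric]
    by (simp add: distrib_left right_diff_distrib mult.left_commute[of \<epsilon>])
qed


section \<open>Lipschitz bounds and convexity\<close>

text \<open>The partial derivatives have positive degree \<open>D - 1\<close>, so they are bounded
  on the ball, and the mean value inequality applies on this convex set.\<close>

lemma spiral_homogeneous_lipschitz:
  assumes "spiral_homogeneous D f" "D > 1"
  shows "\<exists>L. \<forall>x y. norm x \<le> R \<longrightarrow> norm y \<le> R \<longrightarrow> \<bar>f x - f y\<bar> \<le> L * norm (x - y)"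
proof -
  obtain f1 f2 where f: "spiral_homogeneous (D - 1) f1" "spiral_homogeneous (D - 1) f2"
    and der: "\<And>x. (f has_derivative (\<lambda>h. h$1 * f1 x + h$2 * f2 x)) (at x)"
    using spiral_homogeneous_derivative[OF assms(1)] assms(2) by auto
  obtain C1 C2 where C: "C1 \<ge> 0" "\<And>x. \<bar>f1 x\<bar> \<le> C1 * norm x powr (D - 1)"
    "C2 \<ge> 0" "\<And>x. \<bar>f2 x\<bar> \<le> C2 * norm x powr (D - 1)"
    using spiral_homogeneous_bound[OF f(1)] spiral_homogeneous_bound[OF f(2)] by blast
  let ?B = "(C1 + C2) * R powr (D - 1)"
  have "norm (f x - f y) \<le> ?B * norm (x - y)" if "x \<in> cball 0 R" "y \<in> cball 0 R" for x y
  proof (rule differentiable_bound[OF convex_cball _ _ that])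
    fix z :: "real^2" assume z: "z \<in> cball 0 R"
    show "(f has_derivative (\<lambda>h::real^2. h$1 * f1 z + h$2 * f2 z)) (at z within cball 0 R)"
      using der by (rule has_derivative_at_withinI)
    show "onorm (\<lambda>h::real^2. h$1 * f1 z + h$2 * f2 z) \<le> ?B"
    proof (rule onorm_bound)
      fix h :: "real^2"
      have P: "norm z powr (D - 1) \<le> R powr (D - 1)"
        using z assms(2) by (intro powr_mono2) auto
      have "\<bar>f1 z\<bar> \<le> C1 * R powr (D - 1)" "\<bar>f2 z\<bar> \<le> C2 * R powr (D - 1)"
        using C(2,4)[of z] mult_left_mono[OF P C(1)] mult_left_mono[OF P C(3)] by linarith+
      hence "\<bar>h$1\<bar> * \<bar>f1 z\<bar> + \<bar>h$2\<bar> * \<bar>f2 z\<bar> \<le>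
          norm h * (C1 * R powr (D - 1)) + norm h * (C2 * R powr (D - 1))"
        using component_le_norm_cart[of h 1] component_le_norm_cart[of h 2]
        by (intro add_mono mult_mono) auto
      moreover have "norm (h$1 * f1 z + h$2 * f2 z) \<le> \<bar>h$1\<bar> * \<bar>f1 z\<bar> + \<bar>h$2\<bar> * \<bar>f2 z\<bar>"
        by (metis abs_mult abs_triangle_ineq real_norm_def)
      ultimately show "norm (h$1 * f1 z + h$2 * f2 z) \<le> ?B * norm h"
        by (simp add: algebra_simps)
    qed (use C in simp)
  qed
  thus ?thesis by (intro exI[of _ ?B]) auto
qed

text \<open>Both components have degree \<open>2 * q - 1 > 1\<close>. The estimate holds across the
  origin and makes uniqueness of gradient orbits available.\<close>

lemma spiral_gradient_lipschitz:
  assumes "q > 1"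
  shows "\<exists>L. \<forall>x y. norm x \<le> R \<longrightarrow> norm y \<le> R \<longrightarrow>
    norm (spiral_gradient q \<epsilon> x - spiral_gradient q \<epsilon> y) \<le> L * norm (x - y)"
proof -
  have "spiral_homogeneous (2 * q - 1) (\<lambda>x. spiral_gradient q \<epsilon> x $ 1)"
    "spiral_homogeneous (2 * q - 1) (\<lambda>x. spiral_gradient q \<epsilon> x $ 2)"
    unfolding spiral_gradient_def vector_2
    by (intro spiral_homogeneous.add spiral_homogeneous.scale
          spiral_homogeneous_swirl1 spiral_homogeneous_swirl2; simp)+
  from this[THEN spiral_homogeneous_lipschitz, of R] assms
  obtain L1 L2 where "\<forall>x y. norm x \<le> R \<longrightarrow> norm y \<le> R \<longrightarrow>
      \<bar>spiral_gradient q \<epsilon> x $ 1 - spiral_gradient q \<epsilon> y $ 1\<bar> \<le> L1 * norm (x - y)"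
    "\<forall>x y. norm x \<le> R \<longrightarrow> norm y \<le> R \<longrightarrow>
      \<bar>spiral_gradient q \<epsilon> x $ 2 - spiral_gradient q \<epsilon> y $ 2\<bar> \<le> L2 * norm (x - y)"
    by (auto simp del: not_le)
  hence L: "\<And>x y. norm x \<le> R \<Longrightarrow> norm y \<le> R \<Longrightarrow>
      \<bar>spiral_gradient q \<epsilon> x $ 1 - spiral_gradient q \<epsilon> y $ 1\<bar> \<le> L1 * norm (x - y)"
    "\<And>x y. norm x \<le> R \<Longrightarrow> norm y \<le> R \<Longrightarrow>
      \<bar>spiral_gradient q \<epsilon> x $ 2 - spiral_gradient q \<epsilon> y $ 2\<bar> \<le> L2 * norm (x - y)"
    by blast+
  show ?thesis
  proof (intro exI[of _ "L1 + L2"] allI impI)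
    fix x y :: "real^2" assume "norm x \<le> R" "norm y \<le> R"
    from L[OF this]
    show "norm (spiral_gradient q \<epsilon> x - spiral_gradient q \<epsilon> y) \<le> (L1 + L2) * norm (x - y)"
      using norm_le_l1_cart[of "spiral_gradient q \<epsilon> x - spiral_gradient q \<epsilon> y"]
      by (simp add: sum_2 distrib_right)
  qed
qed

text \<open>On the line through \<open>x\<close> and \<open>y\<close> the second derivative is the
  Hessian form at \<open>v = y - x\<close>, so convexity reduces to one variable.\<close>

lemma convex_on_of_second_derivative_real2:
  fixes f :: "real^2 \<Rightarrow> real"
  assumes f: "\<And>x. (f has_derivative (\<lambda>h. h$1 * f1 x + h$2 * f2 x)) (at x)"
    and f1: "\<And>x. (f1 has_derivative (\<lambda>h. h$1 * f11 x + h$2 * f12 x)) (at x)"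
    and f2: "\<And>x. (f2 has_derivative (\<lambda>h. h$1 * f21 x + h$2 * f22 x)) (at x)"
    and pos: "\<And>x v :: real^2. v$1 * (v$1 * f11 x + v$2 * f12 x) + v$2 * (v$1 * f21 x + v$2 * f22 x) \<ge> 0"
  shows "convex_on UNIV f"
proof (rule convex_onI)
  fix t :: real and x y :: "real^2"
  assume t: "0 < t" "t < 1"
  define v where "v = y - x"
  have line: "((\<lambda>s. g (x + s *\<^sub>R v)) has_real_derivative v$1 * g1 (x + s *\<^sub>R v) + v$2 * g2 (x + s *\<^sub>R v)) (at s)"
    if g: "\<And>x. (g has_derivative (\<lambda>h. h$1 * g1 x + h$2 * g2 x)) (at x)" for g g1 g2 :: "real^2 \<Rightarrow> real" and s
  proof -
    have "((\<lambda>s. x + s *\<^sub>R v) has_derivative (\<lambda>s. s *\<^sub>R v)) (at s)"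
      by (auto intro!: derivative_eq_intros)
    from has_derivative_compose[OF this g]
    show ?thesis unfolding has_field_derivative_def
      by (rule has_derivative_eq_rhs) (simp add: fun_eq_iff algebra_simps)
  qed
  have "convex_on UNIV (\<lambda>s. f (x + s *\<^sub>R v))"
  proof (rule f''_ge0_imp_convex[OF convex_UNIV])
    fix s
    show "((\<lambda>s. f (x + s *\<^sub>R v)) has_real_derivative v$1 * f1 (x + s *\<^sub>R v) + v$2 * f2 (x + s *\<^sub>R v)) (at s)"
      by (rule line[OF f])
    show "((\<lambda>s. v$1 * f1 (x + s *\<^sub>R v) + v$2 * f2 (x + s *\<^sub>R v)) has_real_derivative
        v$1 * (v$1 * f11 (x + s *\<^sub>R v) + v$2 * f12 (x + s *\<^sub>R v)) +
        v$2 * (v$1 * f21 (x + s *\<^sub>R v) + v$2 * f22 (x + s *\<^sub>R v))) (at s)"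
      by (intro DERIV_add DERIV_cmult line f1 f2)
  qed (rule pos)
  from convex_onD[OF this, of t 0 1] t
  show "f ((1 - t) *\<^sub>R x + t *\<^sub>R y) \<le> (1 - t) * f x + t * f y"
    by (simp add: v_def algebra_simps)
qed simp

text \<open>The Hessian form of the unperturbed power and that of the wave are both compared with
  \<open>(v \<bullet> v) * P x\<close>. As their degrees agree, one threshold for
  \<open>\<epsilon>\<close> serves at every \<open>x\<close>.\<close>

lemma spiral_potential_convex:
  assumes "q > 1"
  shows "\<exists>\<epsilon>0>0. \<forall>\<epsilon>. 0 < \<epsilon> \<and> \<epsilon> \<le> \<epsilon>0 \<longrightarrow> convex_on UNIV (spiral_potential q \<epsilon>)"
proof -
  let ?W = "spiral_wave q"
  obtain w1 w2 where w: "spiral_homogeneous (2 * q - 1) w1" "spiral_homogeneous (2 * q - 1) w2"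
    and dw: "\<And>x. (?W has_derivative (\<lambda>h. h$1 * w1 x + h$2 * w2 x)) (at x)"
    using spiral_homogeneous_derivative[OF spiral_homogeneous_wave[of q]] assms by auto
  obtain w11 w12 where w1: "spiral_homogeneous (2 * q - 1 - 1) w11" "spiral_homogeneous (2 * q - 1 - 1) w12"
    and dw1: "\<And>x. (w1 has_derivative (\<lambda>h. h$1 * w11 x + h$2 * w12 x)) (at x)"
    using spiral_homogeneous_derivative[OF w(1)] assms by auto
  obtain w21 w22 where w2: "spiral_homogeneous (2 * q - 1 - 1) w21" "spiral_homogeneous (2 * q - 1 - 1) w22"
    and dw2: "\<And>x. (w2 has_derivative (\<lambda>h. h$1 * w21 x + h$2 * w22 x)) (at x)"
    using spiral_homogeneous_derivative[OF w(2)] assms by auto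
  obtain C11 C12 C21 C22 where C:
    "C11 \<ge> 0" "\<And>x. \<bar>w11 x\<bar> \<le> C11 * norm x powr (2 * q - 1 - 1)"
    "C12 \<ge> 0" "\<And>x. \<bar>w12 x\<bar> \<le> C12 * norm x powr (2 * q - 1 - 1)"
    "C21 \<ge> 0" "\<And>x. \<bar>w21 x\<bar> \<le> C21 * norm x powr (2 * q - 1 - 1)"
    "C22 \<ge> 0" "\<And>x. \<bar>w22 x\<bar> \<le> C22 * norm x powr (2 * q - 1 - 1)"
    using spiral_homogeneous_bound[OF w1(1)] spiral_homogeneous_bound[OF w1(2)]
      spiral_homogeneous_bound[OF w2(1)] spiral_homogeneous_bound[OF w2(2)] by (elim exE conjE) blast
  define C where "C = C11 + C12 + C21 + C22"
  have C0: "C \<ge> 0" using C by (simp add: C_def)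
  define P where "P = (\<lambda>x::real^2. norm x powr (2 * q - 1 - 1))"
  have Peq: "swirl 0 0 (q - 1) 0 0 x = P x" for x :: "real^2"
    using assms by (cases "x = 0") (simp_all add: swirl_def P_def inner_powr algebra_simps)
  have Wbound: "\<bar>v$1 * (v$1 * w11 x + v$2 * w12 x) + v$2 * (v$1 * w21 x + v$2 * w22 x)\<bar>
     \<le> C * (v \<bullet> v) * P x" for x v :: "real^2"
  proof -
    have v: "\<bar>v$i * v$j\<bar> \<le> v \<bullet> v" for i j
      using component_le_norm_cart[of v i] component_le_norm_cart[of v j]
      by (simp add: abs_mult dot_square_norm power2_eq_square mult_mono)
    have b: "\<bar>v$i * v$j * w\<bar> \<le> K * (v \<bullet> v) * P x" if "\<bar>w\<bar> \<le> K * P x" for i j w K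
      using mult_mono[OF v[of i j] that] by (simp add: abs_mult ac_simps)
    have "\<bar>v$1 * v$1 * w11 x\<bar> \<le> C11 * (v \<bullet> v) * P x" "\<bar>v$1 * v$2 * w12 x\<bar> \<le> C12 * (v \<bullet> v) * P x"
      "\<bar>v$2 * v$1 * w21 x\<bar> \<le> C21 * (v \<bullet> v) * P x" "\<bar>v$2 * v$2 * w22 x\<bar> \<le> C22 * (v \<bullet> v) * P x"
      using C by (intro b; simp add: P_def)+
    moreover have "v$1 * (v$1 * w11 x + v$2 * w12 x) + v$2 * (v$1 * w21 x + v$2 * w22 x) =
        v$1 * v$1 * w11 x + v$1 * v$2 * w12 x + v$2 * v$1 * w21 x + v$2 * v$2 * w22 x"
      by (simp add: algebra_simps)
    moreover have "C * (v \<bullet> v) * P x = C11 * (v \<bullet> v) * P x + C12 * (v \<bullet> v) * P x + C21 * (v \<bullet> v) * P x + C22 * (v \<bullet> v) * P x"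
      by (simp add: C_def algebra_simps)
    ultimately show ?thesis by linarith
  qed
  \<comment> \<open>The threshold gives \<open>\<epsilon> * C \<le> 1 \<le> 2 * q\<close>; the
    summand 1 avoids a zero denominator.\<close>
  have conv: "convex_on UNIV (spiral_potential q \<epsilon>)" if \<epsilon>: "0 < \<epsilon>" "\<epsilon> \<le> 1 / (1 + C)" for \<epsilon>
  proof (rule convex_on_of_second_derivative_real2)
    let ?A1 = "\<lambda>x. 2 * q * swirl 1 0 (q - 1) 0 0 x" and ?A2 = "\<lambda>x. 2 * q * swirl 0 1 (q - 1) 0 0 x"
    fix x :: "real^2"
    have "(swirl 0 0 q 0 0 has_derivative (\<lambda>h. h$1 * ?A1 x + h$2 * ?A2 x)) (at x)"
      using swirl_has_derivative[of x 0 0 q 0 0] assms by (simp add: swirl1_def swirl2_def)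
    from has_derivative_add[OF this has_derivative_mult_right[OF dw]]
    show "(spiral_potential q \<epsilon> has_derivative
        (\<lambda>h. h$1 * (?A1 x + \<epsilon> * w1 x) + h$2 * (?A2 x + \<epsilon> * w2 x))) (at x)"
      unfolding spiral_potential_def[abs_def]
      by (rule has_derivative_eq_rhs) (simp add: fun_eq_iff algebra_simps)
    let ?B11 = "\<lambda>x. 2 * q * swirl1 1 0 (q - 1) 0 0 x" and ?B12 = "\<lambda>x. 2 * q * swirl2 1 0 (q - 1) 0 0 x"
    let ?B21 = "\<lambda>x. 2 * q * swirl1 0 1 (q - 1) 0 0 x" and ?B22 = "\<lambda>x. 2 * q * swirl2 0 1 (q - 1) 0 0 x"
    have d1: "(swirl 1 0 (q - 1) 0 0 has_derivative
        (\<lambda>h. h$1 * swirl1 1 0 (q - 1) 0 0 x + h$2 * swirl2 1 0 (q - 1) 0 0 x)) (at x)"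
     and d2: "(swirl 0 1 (q - 1) 0 0 has_derivative
        (\<lambda>h. h$1 * swirl1 0 1 (q - 1) 0 0 x + h$2 * swirl2 0 1 (q - 1) 0 0 x)) (at x)"
      using assms by (intro swirl_has_derivative; simp)+
    show "((\<lambda>x. ?A1 x + \<epsilon> * w1 x) has_derivative
        (\<lambda>h. h$1 * (?B11 x + \<epsilon> * w11 x) + h$2 * (?B12 x + \<epsilon> * w12 x))) (at x)"
      by (rule has_derivative_eq_rhs[OF has_derivative_add[OF has_derivative_mult_right[OF d1]
            has_derivative_mult_right[OF dw1]]]) (simp add: fun_eq_iff algebra_simps)
    show "((\<lambda>x. ?A2 x + \<epsilon> * w2 x) has_derivative
        (\<lambda>h. h$1 * (?B21 x + \<epsilon> * w21 x) + h$2 * (?B22 x + \<epsilon> * w22 x))) (at x)"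
      by (rule has_derivative_eq_rhs[OF has_derivative_add[OF has_derivative_mult_right[OF d2]
            has_derivative_mult_right[OF dw2]]]) (simp add: fun_eq_iff algebra_simps)
    fix v :: "real^2"
    define Z where "Z = (x \<bullet> x) powr (q - 1 - 1)"
    \<comment> \<open>The unperturbed Hessian is a multiple of the identity plus a rank-one term,
      which is nonnegative as \<open>q > 1\<close>.\<close>
    have "v$1 * (v$1 * ?B11 x + v$2 * ?B12 x) + v$2 * (v$1 * ?B21 x + v$2 * ?B22 x) =
        2 * q * (v \<bullet> v) * P x + 4 * q * (q - 1) * Z * (x \<bullet> v)\<^sup>2"
      unfolding Peq[symmetric]
      by (simp add: swirl1_def swirl2_def) (simp add: swirl_def Z_def inner_real2[of v v] inner_real2[of x v] algebra_simps power2_eq_square)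
    moreover have "4 * q * (q - 1) * Z * (x \<bullet> v)\<^sup>2 \<ge> 0"
      using assms by (simp add: Z_def)
    ultimately have A: "v$1 * (v$1 * ?B11 x + v$2 * ?B12 x) + v$2 * (v$1 * ?B21 x + v$2 * ?B22 x) \<ge>
        2 * q * (v \<bullet> v) * P x" by linarith
    have "\<epsilon> * C \<le> 1"
    proof -
      have "\<epsilon> * (1 + C) \<le> 1" using \<epsilon> C0 by (simp add: field_simps)
      thus ?thesis using \<epsilon> by (simp add: distrib_left)
    qed
    hence "\<epsilon> * C * ((v \<bullet> v) * P x) \<le> 2 * q * ((v \<bullet> v) * P x)"
      using assms by (intro mult_right_mono) (auto simp: P_def)
    moreover have "\<bar>\<epsilon> * (v$1 * (v$1 * w11 x + v$2 * w12 x) + v$2 * (v$1 * w21 x + v$2 * w22 x))\<bar>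
        \<le> \<epsilon> * (C * (v \<bullet> v) * P x)"
      using mult_left_mono[OF Wbound[of v x], of \<epsilon>] \<epsilon> by (simp add: abs_mult)
    moreover have "v$1 * (v$1 * (?B11 x + \<epsilon> * w11 x) + v$2 * (?B12 x + \<epsilon> * w12 x)) +
        v$2 * (v$1 * (?B21 x + \<epsilon> * w21 x) + v$2 * (?B22 x + \<epsilon> * w22 x)) =
        (v$1 * (v$1 * ?B11 x + v$2 * ?B12 x) + v$2 * (v$1 * ?B21 x + v$2 * ?B22 x)) +
        \<epsilon> * (v$1 * (v$1 * w11 x + v$2 * w12 x) + v$2 * (v$1 * w21 x + v$2 * w22 x))"
      by (simp add: algebra_simps)
    ultimately show "v$1 * (v$1 * (?B11 x + \<epsilon> * w11 x) + v$2 * (?B12 x + \<epsilon> * w12 x)) +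
        v$2 * (v$1 * (?B21 x + \<epsilon> * w21 x) + v$2 * (?B22 x + \<epsilon> * w22 x)) \<ge> 0"
      using A by (simp only: mult.assoc)
  qed
  show ?thesis using conv C0 by (intro exI[of _ "1 / (1 + C)"]) auto
qed


section \<open>Gradient orbits\<close>

lemma GDERIV_imp_eq:
  assumes "GDERIV f x :> v" "GDERIV f x :> w"
  shows "v = w"
proof -
  have "(\<lambda>h. h \<bullet> v) = (\<lambda>h. h \<bullet> w)"
    using has_derivative_unique assms unfolding gderiv_def by blast
  hence "(v - w) \<bullet> v = (v - w) \<bullet> w" by meson
  hence "(v - w) \<bullet> (v - w) = 0" by (simp add: inner_diff_right)
  thus ?thesis by simp
qed

text \<open>Uniqueness of the gradient turns the relational definition into an equation with a fixed
  vector field.\<close>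

lemma gradient_solution_spiral_potential:
  assumes "q > 1/2" "gradient_solution (spiral_potential q \<epsilon>) \<gamma> I" "t \<in> I"
  shows "(\<gamma> has_vector_derivative spiral_gradient q \<epsilon> (\<gamma> t)) (at t within I)"
  using assms GDERIV_imp_eq spiral_potential_GDERIV[OF assms(1)] unfolding gradient_solution_def by metis

text \<open>Velocity in the moving frame: the rates \<open>\<rho>'\<close> and
  \<open>\<theta>'\<close> in the radial and tangential directions, both multiplied by the
  radius.\<close>

lemma log_polar_has_vector_derivative:
  assumes "(\<rho> has_real_derivative \<rho>') (at t)" "(\<theta> has_real_derivative \<theta>') (at t)"
  shows "((\<lambda>t. log_polar (\<rho> t) (\<theta> t)) has_vector_derivative
    exp (\<rho> t) *\<^sub>R vector [\<rho>' * cos (\<theta> t) - \<theta>' * sin (\<theta> t), \<rho>' * sin (\<theta> t) + \<theta>' * cos (\<theta> t)]) (at t)"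
proof -
  have e: "vector [a, b] = a *\<^sub>R axis 1 1 + b *\<^sub>R (axis 2 1 :: real^2)" for a b :: real
    by (simp add: vec_eq_iff forall_2 axis_def)
  have d: "((\<lambda>t. exp (\<rho> t) * cos (\<theta> t)) has_real_derivative exp (\<rho> t) * (\<rho>' * cos (\<theta> t) - \<theta>' * sin (\<theta> t))) (at t)"
    "((\<lambda>t. exp (\<rho> t) * sin (\<theta> t)) has_real_derivative exp (\<rho> t) * (\<rho>' * sin (\<theta> t) + \<theta>' * cos (\<theta> t))) (at t)"
    using assms by (auto intro!: derivative_eq_intros simp: algebra_simps)
  have "((\<lambda>t. (exp (\<rho> t) * cos (\<theta> t)) *\<^sub>R axis 1 1 + (exp (\<rho> t) * sin (\<theta> t)) *\<^sub>R (axis 2 1 :: real^2))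
    has_vector_derivative (exp (\<rho> t) * (\<rho>' * cos (\<theta> t) - \<theta>' * sin (\<theta> t))) *\<^sub>R axis 1 1 +
      (exp (\<rho> t) * (\<rho>' * sin (\<theta> t) + \<theta>' * cos (\<theta> t))) *\<^sub>R axis 2 1) (at t)"
    by (rule has_vector_derivative_eq_rhs[OF has_vector_derivative_add[OF
        has_vector_derivative_scaleR[OF d(1) has_vector_derivative_const]
        has_vector_derivative_scaleR[OF d(2) has_vector_derivative_const]]]) simp
  thus ?thesis by (simp add: log_polar_def e scaleR_add_right)
qed

context spiral_system
begin

abbreviation "f \<equiv> spiral_potential (p / 2) \<epsilon>"
abbreviation "grad \<equiv> spiral_gradient (p / 2) \<epsilon>"

lemma f_log_polar: "f (log_polar \<rho> \<theta>) = exp (p * \<rho>) * (1 + \<epsilon> * cos (\<rho> - \<theta>))"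
  by (simp add: spiral_potential_log_polar)

lemma grad_log_polar: "grad (log_polar \<rho> \<theta>) = exp ((p - 1) * \<rho>) *\<^sub>R
    vector [M (\<rho> - \<theta>) * cos \<theta> - \<epsilon> * sin (\<rho> - \<theta>) * sin \<theta>,
            M (\<rho> - \<theta>) * sin \<theta> + \<epsilon> * sin (\<rho> - \<theta>) * cos \<theta>]"
  using spiral_gradient_log_polar[of p "p/2" \<epsilon> \<rho> \<theta>] by (simp add: M_def)

lemma f_GDERIV: "GDERIV f x :> grad x"
  using p by (intro spiral_potential_GDERIV) simp

lemma f_zero: "f 0 = 0"
  by (rule spiral_homogeneous_zero[OF spiral_homogeneous_potential])

lemma f_pos: "x \<noteq> 0 \<Longrightarrow> f x > 0"
proof -
  assume "x \<noteq> 0"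
  then obtain \<rho> \<theta> where x: "x = log_polar \<rho> \<theta>" using log_polar_exists by blast
  show "f x > 0" unfolding x f_log_polar
    using eps_bounds(1)[of "\<rho> - \<theta>"] by (intro mult_pos_pos) auto
qed

lemma f_arg_min: "is_arg_min f (\<lambda>_. True) x \<longleftrightarrow> x = 0"
proof
  assume "is_arg_min f (\<lambda>_. True) x"
  hence "\<not> f 0 < f x" by (simp add: is_arg_min_def)
  thus "x = 0" using f_pos[of x] by (auto simp: f_zero)
next
  assume "x = 0"
  thus "is_arg_min f (\<lambda>_. True) x"
    using f_pos by (metis f_zero is_arg_min_def less_asym order.irrefl)
qed

text \<open>The exponent matches the degrees \<open>p\<close> of \<open>f\<close> and
  \<open>p - 1\<close> of its gradient. The radial component suffices, and the inequality holds on
  the whole plane with constant 1.\<close>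

lemma f_lojasiewicz: "lojasiewicz_gradient_inequality f 0"
  unfolding lojasiewicz_gradient_inequality_def
proof (intro exI conjI ballI)
  let ?\<theta> = "(p - 1) / p"
  show "0 < ?\<theta>" "?\<theta> < 1" "(0::real) < 1" "open UNIV" "(0::real^2) \<in> UNIV" using p by simp_all
  fix x :: "real^2"
  show "GDERIV f x :> grad x" by (rule f_GDERIV)
  show "1 * \<bar>f x - f 0\<bar> powr ?\<theta> \<le> norm (grad x)"
  proof (cases "x = 0")
    case False
    then obtain \<rho> \<theta> where x: "x = log_polar \<rho> \<theta>" using log_polar_exists by blast
    define \<psi> where "\<psi> = \<rho> - \<theta>"
    have "f x \<le> exp (p * \<rho>) * 2"
      unfolding x f_log_polar using eps_bounds(1)[of "\<rho> - \<theta>"] by (intro mult_left_mono) auto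
    hence "\<bar>f x - f 0\<bar> powr ?\<theta> \<le> (exp (p * \<rho>) * 2) powr ?\<theta>"
      using f_pos[OF False] p by (intro powr_mono2) (auto simp: f_zero)
    also have "\<dots> = exp ((p - 1) * \<rho>) * 2 powr ?\<theta>"
    proof -
      have "exp (p * \<rho>) powr ?\<theta> = exp ((p - 1) * \<rho>)" using p by (simp add: powr_def)
      thus ?thesis by (simp add: powr_mult)
    qed
    also have "\<dots> \<le> exp ((p - 1) * \<rho>) * 2 powr 1"
      using p by (intro mult_left_mono powr_mono) auto
    \<comment> \<open>By \<open>2 \<le> p / 2 \<le> M \<psi>\<close> the factor 2 from the bound on
      \<open>f\<close> is absorbed.\<close>
    also have "\<dots> \<le> exp ((p - 1) * \<rho>) * M \<psi>"
      using M_ge[of \<psi>] p by simp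
    \<comment> \<open>Pairing with the unit vector \<open>log_polar 0 \<theta>\<close> isolates the
      radial component.\<close>
    also have "\<dots> = grad x \<bullet> log_polar 0 \<theta>"
    proof -
      have "(M \<psi> * cos \<theta> - \<epsilon> * sin \<psi> * sin \<theta>) * cos \<theta> + (M \<psi> * sin \<theta> + \<epsilon> * sin \<psi> * cos \<theta>) * sin \<theta> =
          M \<psi> * ((cos \<theta>)\<^sup>2 + (sin \<theta>)\<^sup>2)"
        by algebra
      thus ?thesis unfolding x grad_log_polar \<psi>_def[symmetric] inner_scaleR_left
        by (simp add: inner_real2)
    qed
    also have "\<dots> \<le> norm (grad x)"
      using norm_cauchy_schwarz[of "grad x" "log_polar 0 \<theta>"] by simp
    finally show ?thesis by simp
  qed simp
qed

text \<open>The angle is recovered as \<open>\<rho> - \<psi>\<close> from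
  \<open>polar_solution_exists\<close>, and the moving-frame velocity is matched with
  \<open>grad_log_polar\<close>.\<close>

lemma explicit_solution_exists:
  assumes "x0 \<noteq> 0"
  shows "\<exists>T>0. \<exists>\<rho> \<theta>. log_polar (\<rho> 0) (\<theta> 0) = x0 \<and>
     gradient_solution f (\<lambda>t. log_polar (\<rho> t) (\<theta> t)) {..<T} \<and> continuous_on {..<T} \<theta> \<and>
     filterlim \<rho> at_bot at_bot \<and> filterlim \<rho> at_top (at_left T) \<and>
     filterlim (\<lambda>t. \<bar>\<theta> t\<bar>) at_top at_bot \<and> filterlim (\<lambda>t. \<bar>\<theta> t\<bar>) at_top (at_left T)"
proof -
  obtain \<rho>0 \<theta>0 where x0: "x0 = log_polar \<rho>0 \<theta>0" using log_polar_exists[OF assms] by blast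
  obtain T \<rho> \<psi> where T: "T > 0" and init: "\<rho> 0 = \<rho>0" "\<psi> 0 = \<rho>0 - \<theta>0"
    and d: "\<forall>t<T. (\<rho> has_real_derivative exp ((p - 2) * \<rho> t) * M (\<psi> t)) (at t) \<and>
       (\<psi> has_real_derivative exp ((p - 2) * \<rho> t) * N (\<psi> t)) (at t)"
    and lim: "filterlim \<rho> at_bot at_bot" "filterlim \<rho> at_top (at_left T)"
     "filterlim (\<lambda>t. \<bar>\<rho> t - \<psi> t\<bar>) at_top at_bot" "filterlim (\<lambda>t. \<bar>\<rho> t - \<psi> t\<bar>) at_top (at_left T)"
    using polar_solution_exists[of \<rho>0 "\<rho>0 - \<theta>0"] by (elim exE conjE)
  let ?\<theta> = "\<lambda>t. \<rho> t - \<psi> t"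
  have d\<theta>: "(?\<theta> has_real_derivative exp ((p - 2) * \<rho> t) * (\<epsilon> * sin (\<psi> t))) (at t)" if "t < T" for t
    using DERIV_diff[of \<rho> _ t UNIV \<psi>] d that
    by (intro DERIV_cong[OF DERIV_diff]) (auto simp: M_def N_def algebra_simps)
  have sol: "((\<lambda>t. log_polar (\<rho> t) (?\<theta> t)) has_vector_derivative grad (log_polar (\<rho> t) (?\<theta> t))) (at t)"
    if t: "t < T" for t
  proof (rule has_vector_derivative_eq_rhs[OF log_polar_has_vector_derivative[OF _ d\<theta>[OF t]]])
    show "(\<rho> has_real_derivative exp ((p - 2) * \<rho> t) * M (\<psi> t)) (at t)" using d t by blast
    \<comment> \<open>The radius from the moving frame raises the exponent \<open>p - 2\<close> of
      the polar system to the exponent \<open>p - 1\<close> of the gradient.\<close>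
    have "exp ((p - 1) * \<rho> t) = exp (\<rho> t) * exp ((p - 2) * \<rho> t)"
      by (simp add: algebra_simps flip: exp_add)
    thus "exp (\<rho> t) *\<^sub>R vector [exp ((p - 2) * \<rho> t) * M (\<psi> t) * cos (?\<theta> t) - exp ((p - 2) * \<rho> t) * (\<epsilon> * sin (\<psi> t)) * sin (?\<theta> t),
       exp ((p - 2) * \<rho> t) * M (\<psi> t) * sin (?\<theta> t) + exp ((p - 2) * \<rho> t) * (\<epsilon> * sin (\<psi> t)) * cos (?\<theta> t)] =
       grad (log_polar (\<rho> t) (?\<theta> t))"
      unfolding grad_log_polar by (simp add: vec_eq_iff forall_2 algebra_simps)
  qed
  have "gradient_solution f (\<lambda>t. log_polar (\<rho> t) (?\<theta> t)) {..<T}"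
    unfolding gradient_solution_def
    using sol f_GDERIV by (auto intro: has_vector_derivative_at_within is_interval_io)
  moreover have "continuous_on {..<T} ?\<theta>"
    using d\<theta> DERIV_isCont by (intro continuous_at_imp_continuous_on ballI) blast
  ultimately show ?thesis
    using T lim init x0 by (intro exI[of _ T] conjI exI[of _ \<rho>] exI[of _ ?\<theta>]) auto
qed

text \<open>By uniqueness the orbit agrees with the explicit solution at common times. It cannot
  reach \<open>T\<close>, where the explicit solution is unbounded, and by maximality it covers all
  earlier times.\<close>

lemma maximal_orbit_spirals:
  assumes "maximal_gradient_orbit f \<gamma> I"
  shows "\<exists>T>0. I = {..<T} \<and> spirals_around_origin_at_bot \<gamma> T \<and> spirals_at_infinity_at_left \<gamma> T"
proof -
  have q: "p / 2 > 1/2" "p / 2 > 1" using p by simp_all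
  from assms have I0: "0 \<in> I" and \<gamma>0: "\<gamma> 0 \<noteq> 0" and solI: "gradient_solution f \<gamma> I"
    and maxI: "\<And>\<delta> J. gradient_solution f \<delta> J \<Longrightarrow> I \<subseteq> J \<Longrightarrow> (\<And>t. t \<in> I \<Longrightarrow> \<delta> t = \<gamma> t) \<Longrightarrow> J = I"
    unfolding maximal_gradient_orbit_def by blast+
  have intI: "is_interval I" using solI by (simp add: gradient_solution_def)
  obtain T \<rho> \<theta> where T: "T > 0" and init: "log_polar (\<rho> 0) (\<theta> 0) = \<gamma> 0"
    and sol: "gradient_solution f (\<lambda>t. log_polar (\<rho> t) (\<theta> t)) {..<T}" and cont: "continuous_on {..<T} \<theta>"
    and lim: "filterlim \<rho> at_bot at_bot" "filterlim \<rho> at_top (at_left T)"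
     "filterlim (\<lambda>t. \<bar>\<theta> t\<bar>) at_top at_bot" "filterlim (\<lambda>t. \<bar>\<theta> t\<bar>) at_top (at_left T)"
    using explicit_solution_exists[OF \<gamma>0] by (elim exE conjE)
  define \<delta> where "\<delta> = (\<lambda>t. log_polar (\<rho> t) (\<theta> t))"
  have d\<gamma>: "(\<gamma> has_vector_derivative grad (\<gamma> t)) (at t within I)" if "t \<in> I" for t
    by (rule gradient_solution_spiral_potential[OF q(1) solI that])
  have d\<delta>: "(\<delta> has_vector_derivative grad (\<delta> t)) (at t within {..<T})" if "t < T" for t
    using gradient_solution_spiral_potential[OF q(1) sol, of t] that by (simp add: \<delta>_def)
  have agree: "\<gamma> t = \<delta> t" if t: "t \<in> I" "t < T" for t
  proof (rule vector_ode_unique[where K = "I \<inter> {..<T}" and F = grad and ?t0.0 = 0])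
    show "is_interval (I \<inter> {..<T})" using intI by (intro is_interval_Int is_interval_io)
    show "0 \<in> I \<inter> {..<T}" "t \<in> I \<inter> {..<T}" "\<gamma> 0 = \<delta> 0" using I0 T t init by (auto simp: \<delta>_def)
    show "\<exists>L. \<forall>x y. norm x \<le> R \<longrightarrow> norm y \<le> R \<longrightarrow> norm (grad x - grad y) \<le> L * norm (x - y)" for R
      by (rule spiral_gradient_lipschitz[OF q(2)])
    fix s assume s: "s \<in> I \<inter> {..<T}"
    show "(\<gamma> has_vector_derivative grad (\<gamma> s)) (at s within I \<inter> {..<T})"
      using s by (intro has_vector_derivative_within_subset[OF d\<gamma>]) auto
    show "(\<delta> has_vector_derivative grad (\<delta> s)) (at s within I \<inter> {..<T})"
      using s by (intro has_vector_derivative_within_subset[OF d\<delta>]) auto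
  qed
  have explim: "filterlim (\<lambda>t. exp (\<rho> t)) at_top (at_left T)"
    by (rule filterlim_compose[OF exp_at_top lim(2)])
  \<comment> \<open>Otherwise \<open>\<gamma>\<close> would be bounded on the compact interval
    \<open>{0..T}\<close>, while it agrees with the explicit solution before
    \<open>T\<close>.\<close>
  have "I \<subseteq> {..<T}"
  proof (rule ccontr)
    assume "\<not> I \<subseteq> {..<T}"
    then obtain t where "t \<in> I" "T \<le> t" by force
    have sub: "{0..T} \<subseteq> I"
    proof
      fix s assume "s \<in> {0..T}"
      thus "s \<in> I" using \<open>T \<le> t\<close> by (intro mem_is_interval_1_I[OF intI I0 \<open>t \<in> I\<close>]) auto
    qed
    have "continuous_on I \<gamma>"
      unfolding continuous_on_eq_continuous_within
      by (blast intro: has_vector_derivative_continuous d\<gamma>)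
    hence "compact (\<gamma> ` {0..T})"
      using sub by (intro compact_continuous_image) (auto intro: continuous_on_subset)
    then obtain B where B: "\<And>s. s \<in> {0..T} \<Longrightarrow> norm (\<gamma> s) \<le> B"
      using compact_imp_bounded[OF \<open>compact _\<close>] unfolding bounded_iff by blast
    have "\<forall>\<^sub>F s in at_left T. B < exp (\<rho> s) \<and> s \<in> {0<..<T}"
      using explim eventually_at_left_real[OF T]
      unfolding filterlim_at_top_dense by (auto intro: eventually_conj)
    then obtain s where s: "B < exp (\<rho> s)" "s \<in> {0<..<T}"
      using eventually_happens'[OF trivial_limit_at_left_real] by blast
    hence "s \<in> I" using sub by auto
    hence "norm (\<gamma> s) = exp (\<rho> s)" using agree[of s] s(2) by (simp add: \<delta>_def)
    thus False using B[of s] s by simp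
  qed
  \<comment> \<open>The explicit solution extends \<open>\<gamma>\<close> from \<open>I\<close> to
    \<open>{..<T}\<close>, so maximality forces equality.\<close>
  hence IT: "I = {..<T}"
  proof -
    have "log_polar (\<rho> t) (\<theta> t) = \<gamma> t" if "t \<in> I" for t
      using agree[OF that] that \<open>I \<subseteq> {..<T}\<close> by (auto simp: \<delta>_def)
    from maxI[OF sol \<open>I \<subseteq> {..<T}\<close> this] show ?thesis by simp
  qed
  have \<gamma>: "\<gamma> t = log_polar (\<rho> t) (\<theta> t)" if "t < T" for t
    using agree[of t] that by (simp add: IT \<delta>_def)
  have pol: "polar_angle_of \<gamma> {..<T} \<theta>"
    unfolding polar_angle_of_def
  proof (intro conjI cont ballI)
    fix t assume "t \<in> {..<T}"
    hence g: "\<gamma> t = log_polar (\<rho> t) (\<theta> t)" by (intro \<gamma>) simp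
    have "norm (\<gamma> t) > 0" unfolding g by simp
    thus "\<gamma> t \<noteq> 0" by auto
    show "\<gamma> t /\<^sub>R norm (\<gamma> t) = vector [cos (\<theta> t), sin (\<theta> t)]"
      unfolding g by (simp add: vec_eq_iff forall_2)
  qed
  have "(\<gamma> \<longlongrightarrow> 0) at_bot"
  proof (rule tendsto_norm_zero_cancel, rule Lim_transform_eventually)
    show "((\<lambda>t. exp (\<rho> t)) \<longlongrightarrow> 0) at_bot" by (rule filterlim_compose[OF exp_at_bot lim(1)])
    show "\<forall>\<^sub>F t in at_bot. exp (\<rho> t) = norm (\<gamma> t)"
      using eventually_gt_at_bot[of T] by eventually_elim (simp add: \<gamma>)
  qed
  moreover have "filterlim (\<lambda>t. norm (\<gamma> t)) at_top (at_left T)"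
  proof (rule filterlim_mono_eventually[OF explim order.refl order.refl])
    show "\<forall>\<^sub>F t in at_left T. exp (\<rho> t) = norm (\<gamma> t)"
      using eventually_at_left_real[OF T] by eventually_elim (simp add: \<gamma>)
  qed
  ultimately show ?thesis
    using T IT pol lim(3,4)
    unfolding spirals_around_origin_at_bot_def spirals_at_infinity_at_left_def by blast
qed

end

theorem theorem1p1:
  fixes k :: nat
  shows "\<exists>f :: real^2 \<Rightarrow> real.
    convex_on UNIV f \<and> C_k_on k f UNIV \<and>
    (\<forall>x. is_arg_min f (\<lambda>_. True) x \<longleftrightarrow> x = 0) \<and>
    real_analytic_on f (UNIV - {0}) \<and>
    lojasiewicz_gradient_inequality f 0 \<and>
    (\<forall>\<gamma> I. maximal_gradient_orbit f \<gamma> I \<longrightarrow>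
      (\<exists>T>0. I = {..<T} \<and>
        spirals_around_origin_at_bot \<gamma> T \<and>
        spirals_at_infinity_at_left \<gamma> T))"
proof -
  \<comment> \<open>The degree \<open>2 * q = 2 * k + 4\<close> exceeds \<open>k\<close>, for the
    smoothness class, and is at least 4, for the locale.\<close>
  define q where "q = real k + 2"
  have q: "q > 1" "2 * q > real k" "2 * q \<ge> 4" by (simp_all add: q_def)
  obtain \<epsilon>0 where \<epsilon>0: "\<epsilon>0 > 0"
    "\<And>\<epsilon>. 0 < \<epsilon> \<Longrightarrow> \<epsilon> \<le> \<epsilon>0 \<Longrightarrow> convex_on UNIV (spiral_potential q \<epsilon>)"
    using spiral_potential_convex[OF q(1)] by blast
  \<comment> \<open>The bound \<open>\<epsilon>0\<close> secures convexity, the bound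
    \<open>1/4\<close> the locale assumption.\<close>
  define \<epsilon> where "\<epsilon> = min \<epsilon>0 (1/4)"
  have eps: "0 < \<epsilon>" "\<epsilon> \<le> \<epsilon>0" "\<epsilon> \<le> 1/4" using \<epsilon>0(1) by (simp_all add: \<epsilon>_def)
  interpret spiral_system "2 * q" \<epsilon>
    by unfold_locales (use q eps in auto)
  have h: "spiral_homogeneous (2 * q) (spiral_potential q \<epsilon>)" by (rule spiral_homogeneous_potential)
  \<comment> \<open>Identifies the parameter \<open>p / 2\<close> of the locale results with
    \<open>q\<close>.\<close>
  have [simp]: "2 * q / 2 = q" by simp
  show ?thesis
  proof (intro exI[of _ "spiral_potential q \<epsilon>"] conjI allI impI)
    show "convex_on UNIV (spiral_potential q \<epsilon>)" by (rule \<epsilon>0(2)[OF eps(1,2)])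
    show "C_k_on k (spiral_potential q \<epsilon>) UNIV" by (rule spiral_homogeneous_C_k[OF h q(2)])
    show "is_arg_min (spiral_potential q \<epsilon>) (\<lambda>_. True) x \<longleftrightarrow> x = 0" for x
      using f_arg_min[of x] by simp
    show "real_analytic_on (spiral_potential q \<epsilon>) (UNIV - {0})"
      by (rule spiral_homogeneous_real_analytic[OF h])
    show "lojasiewicz_gradient_inequality (spiral_potential q \<epsilon>) 0"
      using f_lojasiewicz by simp
    show "\<exists>T>0. I = {..<T} \<and> spirals_around_origin_at_bot \<gamma> T \<and> spirals_at_infinity_at_left \<gamma> T"
      if "maximal_gradient_orbit (spiral_potential q \<epsilon>) \<gamma> I" for \<gamma> I
      using maximal_orbit_spirals[of \<gamma> I] that by simp
  qed
qed

end
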